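(* Assume (P1) and (P2), and that $\mathcal{U}$ and $\mathcal{U}^K$ have non-empty interiors. Then, as $N\to\infty$, $v_N\to v^*$ almost surely and $\mathbb{D}(S_N,S)\to0$ almost surely.
   Context: $\mathbf{X}$ is a random vector in $\mathbb{R}^d$ with $\mathbb{E}(|\mathbf{X}|)<\infty$, $\alpha\in(0,1)$, $K>0$, and $(\mathbf{X}^{(j)})_{j\ge1}$ are i.i.d. copies of $\mathbf{X}$. Given bounds $0\le\gamma_i^{low}\le\gamma_i^{up}$ and $\zeta^{low}\le\zeta^{up}$, $\Gamma=\{\boldsymbol{\gamma}:\gamma_i^{low}\le\gamma_i\le\gamma_i^{up}\ \forall i\}$, $\mathcal{U}=\Gamma\times[\zeta^{low},\zeta^{up}]$. $g(\boldsymbol{\gamma},\zeta)=\zeta+(1-\alpha)^{-1}\mathbb{E}\big((-\boldsymbol{\gamma}^T\mathbf{X}-\zeta)^+\big)$, $g_N(\boldsymbol{\gamma},\zeta)=\zeta+\frac{(1-\alpha)^{-1}}{N}\sum_{j=1}^N(-\boldsymbol{\gamma}^T\mathbf{X}^{(j)}-\zeta)^+$. A measurable loss $L(\boldsymbol{\gamma},\zeta,\mathbf{X})$ is given; $\ell(u)=\mathbb{E}(L(u,\mathbf{X}))$, $\ell_N(u)=\frac1N\sum_{j=1}^NL(u,\mathbf{X}^{(j)})$. $\mathcal{U}^K=\{u\in\mathcal{U}:g(u)\le K\}$, $\mathcal{U}_N^K=\{u\in\mathcal{U}:g_N(u)\le K\}$. $v^*=\inf_{\mathcal{U}^K}\ell$,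 $v_N=\inf_{\mathcal{U}_N^K}\ell_N$, $S=\arg\min_{\mathcal{U}^K}\ell$, $S_N=\arg\min_{\mathcal{U}_N^K}\ell_N$. $\mathbb{D}(A,B)=\sup_{x\in A}\inf_{x'\in B}\|x-x'\|$. (P1): almost surely $u\mapsto L(u,\mathbf{X})$ is continuous and convex; (P2): $\mathbb{E}(\sup_{u\in\mathcal{U}}|L(u,\mathbf{X})|)<\infty$. *)

theory Defs
  imports "HOL-Probability.Probability"
begin

definition boxU :: "real^'d \<Rightarrow> real^'d \<Rightarrow> real \<Rightarrow> real \<Rightarrow> ((real^'d) \<times> real) set" where
  "boxU gl gu zl zu = {\<gamma>. \<forall>i. gl$i \<le> \<gamma>$i \<and> \<gamma>$i \<le> gu$i} \<times> {zl..zu}"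

definition gfun :: "'a measure \<Rightarrow> ('a \<Rightarrow> real^'d) \<Rightarrow> real \<Rightarrow> (real^'d) \<times> real \<Rightarrow> real" where
  "gfun M X \<alpha> u = snd u + inverse (1 - \<alpha>) *
      (\<integral>\<omega>. max 0 (- (fst u \<bullet> X \<omega>) - snd u) \<partial>M)"

definition gN :: "(nat \<Rightarrow> 'a \<Rightarrow> real^'d) \<Rightarrow> real \<Rightarrow> nat \<Rightarrow> 'a \<Rightarrow> (real^'d) \<times> real \<Rightarrow> real" where
  "gN Xs \<alpha> N \<omega> u = snd u + inverse (1 - \<alpha>) / real N *
      (\<Sum>j=1..N. max 0 (- (fst u \<bullet> Xs j \<omega>) - snd u))"

definition ell :: "'a measure \<Rightarrow> ((real^'d) \<times> real \<Rightarrow> real^'d \<Rightarrow> real) \<Rightarrow> ('a \<Rightarrow> real^'d)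
    \<Rightarrow> (real^'d) \<times> real \<Rightarrow> real" where
  "ell M L X u = (\<integral>\<omega>. L u (X \<omega>) \<partial>M)"

definition ellN :: "((real^'d) \<times> real \<Rightarrow> real^'d \<Rightarrow> real) \<Rightarrow> (nat \<Rightarrow> 'a \<Rightarrow> real^'d)
    \<Rightarrow> nat \<Rightarrow> 'a \<Rightarrow> (real^'d) \<times> real \<Rightarrow> real" where
  "ellN L Xs N \<omega> u = (\<Sum>j=1..N. L u (Xs j \<omega>)) / real N"

text \<open>Infimum (in the extended reals, inf of empty set = +infinity) and argmin set.\<close>
definition infval :: "('b \<Rightarrow> real) \<Rightarrow> 'b set \<Rightarrow> ereal" where
  "infval f A = (INF u\<in>A. ereal (f u))"

definition argminset :: "('b \<Rightarrow> real) \<Rightarrow> 'b set \<Rightarrow> 'b set" where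
  "argminset f A = {u \<in> A. \<forall>u'\<in>A. f u \<le> f u'}"

definition devD :: "('b::metric_space) set \<Rightarrow> 'b set \<Rightarrow> ereal" where
  "devD A B = (SUP x\<in>A. INF x'\<in>B. ereal (dist x x'))"

end

theory Submission
  imports Defs
begin

text \<open>
  Both sample averages converge uniformly on the compact box \<open>U\<close>, almost surely: for a cover of \<open>U\<close> by
  finitely many small balls, the strong law of large numbers applies at the centres and to the
  oscillation on each ball, whose mean is small by dominated convergence. Uniform convergence of objective
  and constraint yields convergence of values and minimizers as soon as feasible points are limits of
  strictly feasible ones. That follows from convexity of \<open>g\<close> and one strictly feasible point, which
  exists because \<open>g\<close> is positively homogeneous and \<open>K > 0\<close>.

  The strong law comes from the maximal ergodic argument: were the partial sums of i.i.d. variables with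
  negative mean unbounded above with positive probability, then almost surely so by the 0-1 law, and comparing
  the running maximum with its shift would make the mean nonnegative.

  A subtle point is that continuity of the loss is assumed along \<open>X\<close> only, whereas the copies \<open>Xs j\<close>
  share just the distribution of \<open>X\<close>. The set of \<open>x\<close> at which \<open>L (_, x)\<close> is discontinuous is the projection of
  a Borel set, hence need not be Borel; Choquet's capacitability argument shows that it is null nevertheless.
\<close>

section \<open>Projections of Borel sets\<close>

text \<open>Analytic sets as projections of closed sets along Baire space:
  \<open>nat \<Rightarrow> nat\<close> carries the product of discrete topologies. In this form,
  countable unions and intersections reduce to recoding the sequence
  \<open>\<sigma>\<close>.\<close>

definition souslin :: "'e::topological_space set \<Rightarrow> bool" where
  "souslin A \<longleftrightarrow> (\<exists>C :: ('e \<times> (nat \<Rightarrow> nat)) set. closed C \<and> (\<forall>x. x \<in> A \<longleftrightarrow> (\<exists>\<sigma>. (x, \<sigma>) \<in> C)))"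

lemma continuous_on_snd_apply:
  "continuous_on UNIV (\<lambda>p::'e::topological_space \<times> (nat \<Rightarrow> nat). snd p i)"
  by (rule continuous_on_product_then_coordinatewise[OF continuous_on_snd[OF continuous_on_id]])

lemma closed_imp_souslin: "closed A \<Longrightarrow> souslin A"
  unfolding souslin_def by (intro exI[of _ "A \<times> UNIV"]) (auto intro: closed_Times)

text \<open>Entry 0 of the sequence names the index \<open>n\<close>, and its tail witnesses
  membership in \<open>A n\<close>. The set \<open>D\<close> expresses the implication "if
  \<open>\<sigma> 0 = n\<close> then the tail lies in \<open>C n\<close>" for all \<open>n\<close>;
  it is closed because singletons of naturals are open.\<close>

lemma souslin_UN:
  assumes "\<And>n::nat. souslin (A n)"
  shows "souslin (\<Union>n. A n)"
proof -
  have "\<forall>n. \<exists>C :: ('a \<times> (nat \<Rightarrow> nat)) set. closed C \<and> (\<forall>x. x \<in> A n \<longleftrightarrow> (\<exists>\<sigma>. (x, \<sigma>) \<in> C))"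
    using assms by (simp add: souslin_def)
  from choice[OF this] obtain C :: "nat \<Rightarrow> ('a \<times> (nat \<Rightarrow> nat)) set"
    where "\<forall>n. closed (C n) \<and> (\<forall>x. x \<in> A n \<longleftrightarrow> (\<exists>\<sigma>. (x, \<sigma>) \<in> C n))" ..
  then have C: "\<And>n. closed (C n)" "\<And>n x. x \<in> A n \<longleftrightarrow> (\<exists>\<sigma>. (x, \<sigma>) \<in> C n)"
    by simp_all
  define D where "D = (\<Inter>n. (\<lambda>p::'a \<times> (nat \<Rightarrow> nat). snd p 0) -` (- {n}) \<union>
      (\<lambda>p. (fst p, \<lambda>k. snd p (Suc k))) -` C n)"
  have "closed D"
    unfolding D_def
    by (intro closed_INT ballI closed_Un closed_vimage C continuous_on_Pair continuous_on_fst
        continuous_on_coordinatewise_then_product continuous_on_snd_apply continuous_on_id)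
      (auto simp: closed_def intro: discrete_topology_class.open_discrete)
  moreover have "x \<in> (\<Union>n. A n) \<longleftrightarrow> (\<exists>\<sigma>. (x, \<sigma>) \<in> D)" for x
  proof
    assume "x \<in> (\<Union>n. A n)"
    then obtain n \<sigma> where "(x, \<sigma>) \<in> C n" using C(2) by blast
    then have "(x, case_nat n \<sigma>) \<in> D" by (auto simp: D_def)
    then show "\<exists>\<sigma>. (x, \<sigma>) \<in> D" by blast
  next
    assume "\<exists>\<sigma>. (x, \<sigma>) \<in> D"
    then obtain \<sigma> where "(x, \<sigma>) \<in> D" ..
    then have "(x, \<lambda>k. \<sigma> (Suc k)) \<in> C (\<sigma> 0)" by (auto simp: D_def)
    then show "x \<in> (\<Union>n. A n)" using C(2) by blast
  qed
  ultimately show ?thesis unfolding souslin_def by blast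
qed

text \<open>A single sequence carries the witnesses for all \<open>n\<close> at once, interleaved by
  the pairing function.\<close>

lemma souslin_INT:
  assumes "\<And>n::nat. souslin (A n)"
  shows "souslin (\<Inter>n. A n)"
proof -
  have "\<forall>n. \<exists>C :: ('a \<times> (nat \<Rightarrow> nat)) set. closed C \<and> (\<forall>x. x \<in> A n \<longleftrightarrow> (\<exists>\<sigma>. (x, \<sigma>) \<in> C))"
    using assms by (simp add: souslin_def)
  from choice[OF this] obtain C :: "nat \<Rightarrow> ('a \<times> (nat \<Rightarrow> nat)) set"
    where "\<forall>n. closed (C n) \<and> (\<forall>x. x \<in> A n \<longleftrightarrow> (\<exists>\<sigma>. (x, \<sigma>) \<in> C n))" ..
  then have C: "\<And>n. closed (C n)" "\<And>n x. x \<in> A n \<longleftrightarrow> (\<exists>\<sigma>. (x, \<sigma>) \<in> C n)"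
    by simp_all
  define D where "D = (\<Inter>n. (\<lambda>p::'a \<times> (nat \<Rightarrow> nat). (fst p, \<lambda>k. snd p (prod_encode (n, k)))) -` C n)"
  have "closed D"
    unfolding D_def
    by (intro closed_INT ballI closed_vimage C continuous_on_Pair continuous_on_fst
        continuous_on_coordinatewise_then_product continuous_on_snd_apply continuous_on_id)
  moreover have "x \<in> (\<Inter>n. A n) \<longleftrightarrow> (\<exists>\<sigma>. (x, \<sigma>) \<in> D)" for x
  proof
    assume "x \<in> (\<Inter>n. A n)"
    then have "\<forall>n. \<exists>\<sigma>. (x, \<sigma>) \<in> C n" using C(2) by blast
    then obtain s where "\<And>n. (x, s n) \<in> C n" by metis
    then have "(x, \<lambda>m. case prod_decode m of (n, k) \<Rightarrow> s n k) \<in> D" by (auto simp: D_def)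
    then show "\<exists>\<sigma>. (x, \<sigma>) \<in> D" by blast
  next
    assume "\<exists>\<sigma>. (x, \<sigma>) \<in> D"
    then show "x \<in> (\<Inter>n. A n)" by (auto simp: D_def C(2))
  qed
  ultimately show ?thesis unfolding souslin_def by blast
qed

lemma open_imp_souslin:
  fixes A :: "'e::metric_space set"
  assumes "open A"
  shows "souslin A"
proof -
  have "fsigma_in euclidean A"
    using open_imp_fsigma_in[OF metrizable_space_euclidean, of A] assms by simp
  then obtain F where F: "\<And>n::nat. closed (F n)" "\<Union> (range F) = A"
    unfolding fsigma_in_ascending by auto
  then show ?thesis using souslin_UN[of F] closed_imp_souslin by auto
qed

text \<open>Analytic sets are not closed under complement, so the induction carries a set together
  with its complement; each half of a union step uses one of the two previous closure
  properties.\<close>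

lemma borel_imp_souslin:
  fixes A :: "'e::metric_space set"
  assumes "A \<in> sets borel"
  shows "souslin A"
proof -
  have "A \<in> sigma_sets UNIV {S. open S}"
    using assms by (simp add: borel_def)
  then have "souslin A \<and> souslin (- A)"
  proof induction
    case (Basic a)
    then show ?case by (auto intro: open_imp_souslin closed_imp_souslin)
  next
    case (Compl a)
    then show ?case by (simp add: Compl_eq_Diff_UNIV double_diff)
  next
    case (Union a)
    have "- (\<Union>i. a i) = (\<Inter>i. - a i)" by auto
    then show ?case using Union by (auto intro: souslin_UN souslin_INT)
  qed (auto intro: closed_imp_souslin)
  then show ?thesis ..
qed

section \<open>Capacitability of projections\<close>

lemma compact_bounded_sequences: "compact {\<sigma> :: nat \<Rightarrow> nat. \<forall>i. \<sigma> i \<le> b i}"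
proof -
  have "compactin (product_topology (\<lambda>i::nat. euclidean :: nat topology) UNIV) (Pi\<^sub>E UNIV (\<lambda>i. {..b i}))"
    by (subst compactin_PiE) (auto intro: finite_imp_compact)
  moreover have "Pi\<^sub>E UNIV (\<lambda>i. {..b i}) = {\<sigma>. \<forall>i. \<sigma> i \<le> b i}"
    by auto
  ultimately show ?thesis
    by (simp add: euclidean_product_topology)
qed

text \<open>Choquet's argument. Positivity is stated with outer measure because the projection need
  not be Borel. Outer measure is continuous along increasing sequences of arbitrary sets, which
  selects the bounds \<open>n\<close>; measure is continuous along decreasing closed sets, which
  keeps the limit \<open>T\<close> of positive measure; compactness puts \<open>T\<close> back
  inside the projection.\<close>

lemma projection_closed_subset:
  fixes \<mu> :: "'y::metric_space measure" and C :: "(('z::metric_space \<times> 'y) \<times> (nat \<Rightarrow> nat)) set"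
  assumes "finite_measure \<mu>" and sets: "sets \<mu> = sets borel" and U: "compact U" and C: "closed C"
    and pos: "outer_measure_of \<mu> {y. \<exists>z\<in>U. \<exists>\<sigma>. ((z, y), \<sigma>) \<in> C} > 0"
  shows "\<exists>T. closed T \<and> T \<subseteq> {y. \<exists>z\<in>U. \<exists>\<sigma>. ((z, y), \<sigma>) \<in> C} \<and> emeasure \<mu> T > 0"
proof -
  interpret finite_measure \<mu> by fact
  have space: "space \<mu> = UNIV" using sets_eq_imp_space_eq[OF sets] by simp
  \<comment> \<open>Bound the coordinates of \<open>\<sigma>\<close> one by one, keeping the outer measure above a fixed \<open>a > 0\<close>; the bounded sequences form a compact set.\<close>
  define A where "A k n = {y. \<exists>z\<in>U. \<exists>\<sigma>. ((z, y), \<sigma>) \<in> C \<and> (\<forall>i<k. \<sigma> i \<le> n i)}"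
    for k :: nat and n :: "nat \<Rightarrow> nat"
  obtain a where a: "0 < a" "a < outer_measure_of \<mu> {y. \<exists>z\<in>U. \<exists>\<sigma>. ((z, y), \<sigma>) \<in> C}"
    using dense[OF pos] by auto
  have A_cong: "A k f = A k g" if "\<And>i. i < k \<Longrightarrow> f i = g i" for k f g
    using that by (auto simp: A_def)
  have "\<exists>F. \<forall>k. outer_measure_of \<mu> (A k (F k)) > a \<and> (\<exists>m. F (Suc k) = (F k)(k := m))"
  proof (rule dependent_nat_choice)
    show "\<exists>f. outer_measure_of \<mu> (A 0 f) > a"
      using a by (simp add: A_def)
  next
    fix f k assume *: "outer_measure_of \<mu> (A k f) > a"
    have "(\<forall>i<Suc k. \<sigma> i \<le> (f(k := m)) i) \<longleftrightarrow> (\<forall>i<k. \<sigma> i \<le> f i) \<and> \<sigma> k \<le> m" for \<sigma> m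
      by (auto simp: less_Suc_eq)
    then have A_Suc: "A (Suc k) (f(k := m)) =
        {y. \<exists>z\<in>U. \<exists>\<sigma>. ((z, y), \<sigma>) \<in> C \<and> (\<forall>i<k. \<sigma> i \<le> f i) \<and> \<sigma> k \<le> m}" for m
      unfolding A_def by (simp only:)
    have "incseq (\<lambda>m. A (Suc k) (f(k := m)))"
      unfolding incseq_def A_Suc using order_trans by blast
    moreover have "(\<Union>m. A (Suc k) (f(k := m))) = A k f"
      unfolding A_Suc unfolding A_def by auto
    ultimately have "(SUP m. outer_measure_of \<mu> (A (Suc k) (f(k := m)))) = outer_measure_of \<mu> (A k f)"
      using SUP_outer_measure_of_incseq[of "\<lambda>m. A (Suc k) (f(k := m))" \<mu>] by (simp add: space)
    with * obtain m where "outer_measure_of \<mu> (A (Suc k) (f(k := m))) > a"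
      by (metis less_SUP_iff)
    then show "\<exists>g. outer_measure_of \<mu> (A (Suc k) g) > a \<and> (\<exists>m. g = f(k := m))" by blast
  qed
  then obtain F where F: "\<And>k. outer_measure_of \<mu> (A k (F k)) > a" "\<And>k. \<exists>m. F (Suc k) = (F k)(k := m)"
    by blast
  \<comment> \<open>Stage \<open>k\<close> alters coordinate \<open>k\<close> only, so coordinate
    \<open>i\<close> is final from stage \<open>Suc i\<close> on.\<close>
  define n where "n i = F (Suc i) i" for i
  have Fn: "F k i = n i" if "i < k" for k i
    using that
  proof (induction k)
    case (Suc k)
    obtain m where "F (Suc k) = (F k)(k := m)" using F(2) by blast
    then show ?case using Suc by (cases "i = k") (auto simp: n_def)
  qed simp
  have An: "outer_measure_of \<mu> (A k n) > a" for k
    using F(1)[of k] A_cong[of k "F k" n] Fn by simp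
  \<comment> \<open>The sets \<open>A k n\<close> need not be measurable; their closures are, and
    inherit the lower bound \<open>a\<close>.\<close>
  define T where "T = (\<Inter>k. closure (A k n))"
  have "decseq (\<lambda>k. closure (A k n))"
    unfolding decseq_def A_def using less_le_trans
    by (intro allI impI closure_mono Collect_mono) blast
  then have "emeasure \<mu> T = (INF k. emeasure \<mu> (closure (A k n)))"
    unfolding T_def by (intro INF_emeasure_decseq[symmetric]) (auto simp: sets)
  also have "\<dots> \<ge> a"
  proof (rule INF_greatest)
    fix k
    have "outer_measure_of \<mu> (A k n) \<le> outer_measure_of \<mu> (closure (A k n))"
      by (intro outer_measure_of_mono closure_subset)
    then show "a \<le> emeasure \<mu> (closure (A k n))"
      using An[of k] by (simp add: sets)
  qed
  finally have "emeasure \<mu> T > 0" using a(1) by order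
  moreover have "closed T" by (auto simp: T_def)
  moreover have "\<exists>z\<in>U. \<exists>\<sigma>. ((z, y), \<sigma>) \<in> C" if "y \<in> T" for y
  proof -
    have "\<exists>w\<in>A k n. dist w y < inverse (Suc k)" for k
      using that by (auto simp: T_def closure_approachable)
    then obtain w where w: "\<And>k. w k \<in> A k n" "\<And>k. dist (w k) y < inverse (Suc k)"
      by metis
    have "\<forall>k. \<exists>z \<sigma>. z \<in> U \<and> ((z, w k), \<sigma>) \<in> C \<and> (\<forall>i<k. \<sigma> i \<le> n i)"
      using w(1) unfolding A_def by blast
    then obtain z \<sigma> where z: "\<And>k. z k \<in> U" "\<And>k. ((z k, w k), \<sigma> k) \<in> C" "\<And>k i. i < k \<Longrightarrow> \<sigma> k i \<le> n i"
      by metis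
    \<comment> \<open>The bound \<open>n i\<close> holds for \<open>\<sigma> k i\<close> only when
      \<open>i < k\<close>. The finitely many exceptions \<open>k \<le> i\<close> are absorbed by
      the sum, so all \<open>\<sigma> k\<close> lie in one compact box.\<close>
    define b where "b i = n i + (\<Sum>j\<le>i. \<sigma> j i)" for i
    have "\<sigma> k i \<le> b i" for k i
    proof (cases "i < k")
      case False
      then have "\<sigma> k i \<le> (\<Sum>j\<le>i. \<sigma> j i)" by (intro member_le_sum) auto
      then show ?thesis by (simp add: b_def)
    qed (use z(3)[of i k] in \<open>simp add: b_def\<close>)
    then have mem: "\<forall>k. (z k, \<sigma> k) \<in> U \<times> {\<sigma>. \<forall>i. \<sigma> i \<le> b i}" using z by auto
    have "seq_compact (U \<times> {\<sigma>. \<forall>i. \<sigma> i \<le> b i})"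
      by (intro compact_imp_seq_compact compact_Times U compact_bounded_sequences)
    then obtain l r where l: "l \<in> U \<times> {\<sigma>. \<forall>i. \<sigma> i \<le> b i}" and r: "strict_mono (r :: nat \<Rightarrow> nat)"
      and lim: "((\<lambda>k. (z k, \<sigma> k)) \<circ> r) \<longlonglongrightarrow> l"
      using mem by (rule seq_compactE)
    have "(\<lambda>k. dist (w k) y) \<longlonglongrightarrow> 0"
      by (rule tendsto_sandwich[OF _ _ tendsto_const LIMSEQ_inverse_real_of_nat])
        (use w(2) in \<open>auto intro!: always_eventually less_imp_le\<close>)
    then have "w \<longlonglongrightarrow> y" by (rule tendsto_dist_iff[THEN iffD2])
    then have "(w \<circ> r) \<longlonglongrightarrow> y" by (rule LIMSEQ_subseq_LIMSEQ[OF _ r])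
    moreover have "(\<lambda>k. z (r k)) \<longlonglongrightarrow> fst l" "(\<lambda>k. \<sigma> (r k)) \<longlonglongrightarrow> snd l"
      using tendsto_fst[OF lim] tendsto_snd[OF lim] by (simp_all add: o_def)
    ultimately have "(\<lambda>k. ((z (r k), w (r k)), \<sigma> (r k))) \<longlonglongrightarrow> ((fst l, y), snd l)"
      by (auto intro!: tendsto_Pair simp: o_def)
    then have "((fst l, y), snd l) \<in> C"
      by (rule closed_sequentially[OF C, rotated]) (use z(2) in auto)
    then show ?thesis using l by auto
  qed
  ultimately show ?thesis by blast
qed

lemma projection_null:
  fixes \<mu> :: "'y::metric_space measure" and B :: "('z::metric_space \<times> 'y) set"
  assumes "finite_measure \<mu>" and sets: "sets \<mu> = sets borel" and U: "compact U" and B: "B \<in> sets borel"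
    and null: "\<And>T. closed T \<Longrightarrow> (\<And>y. y \<in> T \<Longrightarrow> \<exists>z\<in>U. (z, y) \<in> B) \<Longrightarrow> emeasure \<mu> T = 0"
  shows "AE y in \<mu>. \<forall>z\<in>U. (z, y) \<notin> B"
proof -
  have space: "space \<mu> = UNIV" using sets_eq_imp_space_eq[OF sets] by simp
  obtain C :: "(('z \<times> 'y) \<times> (nat \<Rightarrow> nat)) set"
    where C: "closed C" "\<And>x. x \<in> B \<longleftrightarrow> (\<exists>\<sigma>. (x, \<sigma>) \<in> C)"
    using borel_imp_souslin[OF B] unfolding souslin_def by blast
  let ?P = "{y. \<exists>z\<in>U. \<exists>\<sigma>. ((z, y), \<sigma>) \<in> C}"
  have "outer_measure_of \<mu> ?P = 0"
  proof (rule ccontr)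
    assume "outer_measure_of \<mu> ?P \<noteq> 0"
    then have "outer_measure_of \<mu> ?P > 0" by (simp add: zero_less_iff_neq_zero)
    from projection_closed_subset[OF assms(1,2) U C(1) this]
    obtain T where "closed T" "T \<subseteq> ?P" "emeasure \<mu> T > 0" by blast
    then show False using null[of T] C(2) by fastforce
  qed
  then obtain N where "N \<in> sets \<mu>" "?P \<subseteq> N" "emeasure \<mu> N = 0"
    using outer_measure_of_attain[of ?P \<mu>] by (auto simp: space)
  then show ?thesis
    by (intro AE_I'[of N]) (auto simp: C(2) null_sets_def)
qed

section \<open>The strong law of large numbers\<close>

text \<open>The running maximum of \<open>0\<close> and the partial sums \<open>y 0, y 0 + y 1, \<dots>\<close>, with the first summand split off.\<close>

primrec max_sum :: "nat \<Rightarrow> (nat \<Rightarrow> real) \<Rightarrow> real" where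
  "max_sum 0 y = 0"
| "max_sum (Suc n) y = max 0 (y 0 + max_sum n (\<lambda>i. y (Suc i)))"

lemma max_sum_nonneg: "0 \<le> max_sum n y"
  by (cases n) auto

lemma max_sum_le_Suc: "max_sum n y \<le> max_sum (Suc n) y"
proof (induction n arbitrary: y)
  case (Suc n)
  have "max 0 (y 0 + max_sum n (\<lambda>i. y (Suc i))) \<le> max 0 (y 0 + max_sum (Suc n) (\<lambda>i. y (Suc i)))"
    using Suc[of "\<lambda>i. y (Suc i)"] by (intro max.mono add_left_mono) auto
  then show ?case by (simp only: max_sum.simps(2))
qed simp

lemma incseq_max_sum: "incseq (\<lambda>n. max_sum n y)"
  by (intro incseq_SucI max_sum_le_Suc)

lemma sum_le_max_sum: "(\<Sum>i<n. y i) \<le> max_sum n y"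
proof (induction n arbitrary: y)
  case (Suc n)
  then show ?case
    using Suc[of "\<lambda>i. y (Suc i)"] by (simp only: sum.lessThan_Suc_shift) (simp add: max.coboundedI2)
qed simp

lemma measurable_max_sum [measurable]:
  "max_sum n \<in> borel_measurable (Pi\<^sub>M UNIV (\<lambda>_. borel))"
proof (induction n)
  case (Suc n)
  have "(\<lambda>y i. y (Suc i)) \<in> Pi\<^sub>M UNIV (\<lambda>_. borel) \<rightarrow>\<^sub>M Pi\<^sub>M UNIV (\<lambda>_. borel :: real measure)"
    by (rule measurable_PiM_single') (auto simp: space_PiM PiE_def)
  then have [measurable]: "(\<lambda>y. max_sum n (\<lambda>i. y (Suc i))) \<in> borel_measurable (Pi\<^sub>M UNIV (\<lambda>_. borel))"
    using Suc by (rule measurable_compose)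
  show ?case by simp
qed simp

text \<open>Removing the first summand changes the running maximum by a bounded amount, so
  unboundedness depends only on the tail of the sequence.\<close>

lemma unbounded_max_sum_shift:
  "(\<forall>B. \<exists>n. B < max_sum n y) \<longleftrightarrow> (\<forall>B. \<exists>n. B < max_sum n (\<lambda>i. y (i + k)))"
proof (induction k)
  case (Suc k)
  have "(\<forall>B. \<exists>n. B < max_sum n z) \<longleftrightarrow> (\<forall>B. \<exists>n. B < max_sum n (\<lambda>i. z (Suc i)))" for z
  proof
    assume *: "\<forall>B. \<exists>n. B < max_sum n z"
    show "\<forall>B. \<exists>n. B < max_sum n (\<lambda>i. z (Suc i))"
    proof
      fix B
      obtain n where n: "max 0 (z 0 + B) < max_sum n z" using * by blast
      then obtain m where "n = Suc m" by (cases n) auto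
      with n show "\<exists>n. B < max_sum n (\<lambda>i. z (Suc i))"
        by (auto simp: max_def split: if_splits intro!: exI[of _ m])
    qed
  next
    assume *: "\<forall>B. \<exists>n. B < max_sum n (\<lambda>i. z (Suc i))"
    show "\<forall>B. \<exists>n. B < max_sum n z"
    proof
      fix B
      obtain n where "B - z 0 < max_sum n (\<lambda>i. z (Suc i))" using * by blast
      then show "\<exists>n. B < max_sum n z" by (intro exI[of _ "Suc n"]) auto
    qed
  qed
  from this[of "\<lambda>i. y (i + k)"] show ?case using Suc by simp
qed simp

section \<open>Zero-one law and maximal ergodic argument\<close>

context prob_space
begin

lemma indep_sets_reindex:
  assumes inj: "inj_on f J" and indep: "indep_sets F (f ` J)"
  shows "indep_sets (\<lambda>i. F (f i)) J"
  unfolding indep_sets_def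
proof (intro conjI ballI allI impI)
  show "F (f i) \<subseteq> events" if "i \<in> J" for i
    using indep that unfolding indep_sets_def by blast
next
  fix K A assume K: "K \<subseteq> J" "K \<noteq> {}" "finite K" and A: "A \<in> (\<Pi> i\<in>K. F (f i))"
  have inj': "inj_on f K" using inj K(1) by (rule inj_on_subset)
  define B where "B = (\<lambda>j. A (the_inv_into K f j))"
  have B: "B (f i) = A i" if "i \<in> K" for i
    using that by (simp add: B_def the_inv_into_f_f[OF inj'])
  have "prob (\<Inter>j\<in>f ` K. B j) = (\<Prod>j\<in>f ` K. prob (B j))"
    using K A B by (intro indep_setsD[OF indep]) (auto simp: Pi_iff)
  also have "(\<Prod>j\<in>f ` K. prob (B j)) = (\<Prod>i\<in>K. prob (A i))"
    using B by (simp add: prod.reindex[OF inj'])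
  finally show "prob (\<Inter>i\<in>K. A i) = (\<Prod>i\<in>K. prob (A i))"
    using B by simp
qed

text \<open>Serves two shifts: discarding the first variable of a sequence, and passing from the
  index set \<open>{1..}\<close> to all naturals.\<close>

lemma indep_vars_reindex:
  assumes "inj_on f J" and "indep_vars M' X (f ` J)"
  shows "indep_vars (\<lambda>i. M' (f i)) (\<lambda>i. X (f i)) J"
  using assms indep_sets_reindex[OF assms(1), of "\<lambda>i. {X i -` A \<inter> space M | A. A \<in> sets (M' i)}"]
  unfolding indep_vars_def2 by blast

text \<open>By shift invariance the event can be written with \<open>Y k\<close>,
  \<open>Y (k + 1)\<close>, ... alone, hence it is measurable for the sigma-algebra \<open>N\<close>
  they generate, for every \<open>k\<close>.\<close>

lemma unbounded_max_sum_0_1: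
  fixes Y :: "nat \<Rightarrow> 'a \<Rightarrow> real"
  assumes indep: "indep_vars (\<lambda>_. borel) Y UNIV"
  defines "T \<equiv> {\<omega>\<in>space M. \<forall>B. \<exists>n. B < max_sum n (\<lambda>i. Y i \<omega>)}"
  shows "prob T = 0 \<or> prob T = 1"
proof (rule kolmogorov_0_1_law)
  let ?A = "\<lambda>i. {Y i -` B \<inter> space M | B. B \<in> sets borel}"
  show "sigma_algebra (space M) (?A i)" for i
    using sets.sigma_algebra_axioms[of "vimage_algebra (space M) (Y i) borel"]
    by (simp add: sets_vimage_algebra2)
  show "indep_sets ?A UNIV"
    using indep unfolding indep_vars_def2 by simp
  show "T \<in> tail_events ?A"
    unfolding tail_events_def
  proof
    fix k
    define N where "N = sigma (space M) (\<Union>(?A ` {k..}))"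
    have sub: "\<Union>(?A ` {k..}) \<subseteq> Pow (space M)" by auto
    have [simp]: "space N = space M" by (simp add: N_def space_measure_of[OF sub])
    have "Y (i + k) \<in> borel_measurable N" for i
      unfolding N_def by (rule measurableI)
        (auto simp: sets_measure_of[OF sub] space_measure_of[OF sub] intro!: sigma_sets.Basic bexI[of _ "i + k"] exI)
    then have [measurable]: "(\<lambda>\<omega> i. Y (i + k) \<omega>) \<in> N \<rightarrow>\<^sub>M Pi\<^sub>M UNIV (\<lambda>_. borel)"
      by (intro measurable_PiM_single') auto
    have "T = {\<omega>\<in>space N. \<forall>B. \<exists>n. B < max_sum n (\<lambda>i. Y (i + k) \<omega>)}"
      unfolding T_def by (subst unbounded_max_sum_shift[of _ k]) simp
    \<comment> \<open>Natural bounds suffice and make the quantifier countable.\<close>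
    also have "\<dots> = {\<omega>\<in>space N. \<forall>b::nat. \<exists>n. real b < max_sum n (\<lambda>i. Y (i + k) \<omega>)}"
      by (meson less_trans reals_Archimedean2)
    also have "\<dots> \<in> sets N" by measurable
    finally show "T \<in> sigma_sets (space M) (\<Union>(?A ` {k..}))"
      by (simp add: N_def sets_measure_of[OF sub])
  qed
qed

text \<open>The running maximum over \<open>Suc n\<close> terms minus that of the shifted sequence
  over \<open>n\<close> terms is \<open>max (- m') (Y 0)\<close>, with \<open>m'\<close> the shifted
  maximum. Its mean is nonnegative by stationarity. If the maxima were almost surely unbounded, it
  would tend to \<open>Y 0\<close>, forcing a nonnegative mean of \<open>Y 0\<close>; the 0-1 law
  leaves only probability zero.\<close>

lemma bounded_max_sum_AE:
  fixes Y :: "nat \<Rightarrow> 'a \<Rightarrow> real"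
  assumes indep: "indep_vars (\<lambda>_. borel) Y UNIV"
    and ident: "\<And>j. distr M borel (Y j) = distr M borel (Y 0)"
    and int: "integrable M (Y 0)" and neg: "expectation (Y 0) < 0"
  shows "AE \<omega> in M. \<exists>B. \<forall>n. max_sum n (\<lambda>i. Y i \<omega>) \<le> B"
proof -
  have Y [measurable]: "Y j \<in> borel_measurable M" for j
    using indep unfolding indep_vars_def2 by simp
  let ?P = "Pi\<^sub>M UNIV (\<lambda>_::nat. borel :: real measure)"
  have seq [measurable]: "(\<lambda>\<omega> i. Y (f i) \<omega>) \<in> M \<rightarrow>\<^sub>M ?P" for f
    by (intro measurable_PiM_single') auto
  \<comment> \<open>Independence and equal marginals make the law of the whole sequence a product
    measure, which the shift preserves.\<close>
  have "indep_vars (\<lambda>_. borel) (\<lambda>i. Y (Suc i)) UNIV"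
    using indep_vars_reindex[of Suc UNIV "\<lambda>_. borel" Y] indep_vars_subset[OF indep] by simp
  then have "distr M ?P (\<lambda>\<omega> i. Y (Suc i) \<omega>) = Pi\<^sub>M UNIV (\<lambda>i. distr M borel (Y (Suc i)))"
    by (subst (asm) indep_vars_iff_distr_eq_PiM) (auto simp: restrict_def)
  also have "\<dots> = Pi\<^sub>M UNIV (\<lambda>i. distr M borel (Y i))"
    using ident by metis
  also have "\<dots> = distr M ?P (\<lambda>\<omega> i. Y i \<omega>)"
    using indep by (subst (asm) indep_vars_iff_distr_eq_PiM) (auto simp: restrict_def)
  finally have shift: "distr M ?P (\<lambda>\<omega> i. Y (Suc i) \<omega>) = distr M ?P (\<lambda>\<omega> i. Y i \<omega>)" .
  have intY: "integrable M (Y j)" for j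
  proof -
    have "integrable (distr M borel (Y j)) (\<lambda>x. x)"
      using int by (subst ident) (simp add: integrable_distr_eq)
    then show ?thesis by (simp add: integrable_distr_eq)
  qed
  have int_max: "integrable M (\<lambda>\<omega>. max_sum n (\<lambda>i. Y (i + k) \<omega>))" for n k
  proof (induction n arbitrary: k)
    case (Suc n)
    have "integrable M (\<lambda>\<omega>. max_sum n (\<lambda>i. Y (Suc i + k) \<omega>))" using Suc[of "Suc k"] by simp
    then show ?case using intY[of k] by (simp add: integrable_max)
  qed simp
  let ?m = "\<lambda>n \<omega>. max_sum n (\<lambda>i. Y i \<omega>)" and ?m' = "\<lambda>n \<omega>. max_sum n (\<lambda>i. Y (Suc i) \<omega>)"
  have int1: "integrable M (?m n)" "integrable M (?m' n)" for n
    using int_max[of n 0] int_max[of n 1] by simp_all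
  have "expectation (?m' n) = expectation (?m n)" for n
  proof -
    have "expectation (?m' n) = integral\<^sup>L (distr M ?P (\<lambda>\<omega> i. Y (Suc i) \<omega>)) (max_sum n)"
      by (subst integral_distr) auto
    also have "\<dots> = expectation (?m n)"
      unfolding shift by (subst integral_distr) auto
    finally show ?thesis .
  qed
  moreover have "expectation (?m n) \<le> expectation (?m (Suc n))" for n
    by (intro integral_mono int1 max_sum_le_Suc)
  ultimately have pos: "0 \<le> expectation (\<lambda>\<omega>. ?m (Suc n) \<omega> - ?m' n \<omega>)" for n
    by (subst Bochner_Integration.integral_diff[OF int1]) (simp del: max_sum.simps)
  have eq: "?m (Suc n) \<omega> - ?m' n \<omega> = max (- ?m' n \<omega>) (Y 0 \<omega>)" for n \<omega>
    by simp
  define T where "T = {\<omega>\<in>space M. \<forall>B. \<exists>n. B < ?m n \<omega>}"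
  have T_eq: "T = {\<omega>\<in>space M. \<forall>b::nat. \<exists>n. real b < ?m n \<omega>}"
    unfolding T_def by (meson less_trans reals_Archimedean2)
  have T [measurable]: "T \<in> sets M" unfolding T_eq by measurable
  have "prob T \<noteq> 1"
  proof
    assume "prob T = 1"
    then have "AE \<omega> in M. \<omega> \<in> T" by (simp add: prob_eq_1)
    then have "AE \<omega> in M. (\<lambda>n. ?m (Suc n) \<omega> - ?m' n \<omega>) \<longlonglongrightarrow> Y 0 \<omega>"
    proof eventually_elim
      case (elim \<omega>)
      then have "\<forall>B. \<exists>n. B < ?m' n \<omega>"
        using unbounded_max_sum_shift[of "\<lambda>i. Y i \<omega>" 1] by (simp add: T_def)
      then obtain n where n: "- Y 0 \<omega> < ?m' n \<omega>" by blast
      have "max (- ?m' k \<omega>) (Y 0 \<omega>) = Y 0 \<omega>" if "k \<ge> n" for k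
        using incseqD[OF incseq_max_sum that, of "\<lambda>i. Y (Suc i) \<omega>"] n by simp
      then have "\<forall>\<^sub>F k in sequentially. max (- ?m' k \<omega>) (Y 0 \<omega>) = Y 0 \<omega>"
        unfolding eventually_sequentially by blast
      then show ?case unfolding eq by (rule tendsto_eventually)
    qed
    \<comment> \<open>Since \<open>- ?m' n \<omega>\<close> is at most 0, the maximum either equals
      \<open>Y 0 \<omega>\<close> or lies between \<open>Y 0 \<omega>\<close> and 0; this gives the
      dominating function.\<close>
    moreover have "norm (?m (Suc n) \<omega> - ?m' n \<omega>) \<le> \<bar>Y 0 \<omega>\<bar>" for n \<omega>
      unfolding eq using max_sum_nonneg[of n "\<lambda>i. Y (Suc i) \<omega>"] by (simp add: max_def abs_if)
    ultimately have "(\<lambda>n. expectation (\<lambda>\<omega>. ?m (Suc n) \<omega> - ?m' n \<omega>)) \<longlonglongrightarrow> expectation (Y 0)"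
      using int by (intro integral_dominated_convergence[where w = "\<lambda>\<omega>. \<bar>Y 0 \<omega>\<bar>"]) auto
    then have "0 \<le> expectation (Y 0)"
      by (rule LIMSEQ_le_const) (use pos in blast)
    with neg show False by simp
  qed
  then have "prob T = 0"
    using unbounded_max_sum_0_1[OF indep] by (simp add: T_def)
  then have "AE \<omega> in M. \<omega> \<notin> T"
    using prob_eq_0 by simp
  then show ?thesis
    using AE_space by eventually_elim (auto simp: T_def not_less)
qed

text \<open>Partial sums of \<open>c * Y i - d\<close> are bounded above as soon as the mean of
  \<open>c * Y 0\<close> is below \<open>d\<close>. Division by \<open>n\<close> turns this into
  one-sided bounds on the averages, with \<open>c = 1\<close> from above and \<open>c = -1\<close>
  from below.\<close>

theorem strong_law_of_large_numbers:
  fixes Y :: "nat \<Rightarrow> 'a \<Rightarrow> real"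
  assumes indep: "indep_vars (\<lambda>_. borel) Y UNIV"
    and ident: "\<And>j. distr M borel (Y j) = distr M borel (Y 0)"
    and int: "integrable M (Y 0)"
  shows "AE \<omega> in M. (\<lambda>n. (\<Sum>i<n. Y i \<omega>) / n) \<longlonglongrightarrow> expectation (Y 0)"
proof -
  have Y [measurable]: "Y j \<in> borel_measurable M" for j
    using indep unfolding indep_vars_def2 by simp
  have bnd: "AE \<omega> in M. \<exists>B. \<forall>n. (\<Sum>i<n. c * Y i \<omega> - d) \<le> B"
    if "c * expectation (Y 0) < d" for c d :: real
  proof -
    have "AE \<omega> in M. \<exists>B. \<forall>n. max_sum n (\<lambda>i. c * Y i \<omega> - d) \<le> B"
    proof (rule bounded_max_sum_AE)
      show "indep_vars (\<lambda>_. borel) (\<lambda>i \<omega>. c * Y i \<omega> - d) UNIV"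
        by (rule indep_vars_compose2[OF indep, of "\<lambda>_ x. c * x - d"]) simp
      show "distr M borel (\<lambda>\<omega>. c * Y j \<omega> - d) = distr M borel (\<lambda>\<omega>. c * Y 0 \<omega> - d)" for j
        using arg_cong[OF ident[of j], of "\<lambda>D. distr D borel (\<lambda>x. c * x - d)"]
        by (simp add: distr_distr o_def)
      show "integrable M (\<lambda>\<omega>. c * Y 0 \<omega> - d)" using int by simp
      show "expectation (\<lambda>\<omega>. c * Y 0 \<omega> - d) < 0" using int that by (simp add: prob_space)
    qed
    then show ?thesis
      by eventually_elim (meson order_trans sum_le_max_sum)
  qed
  define \<mu> where "\<mu> = expectation (Y 0)"
  \<comment> \<open>The excess of \<open>d\<close> over the mean runs through
    \<open>inverse (Suc k)\<close>, so one null set serves all accuracies.\<close>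
  have "AE \<omega> in M. \<forall>k::nat. \<forall>c\<in>{1, -1}. \<exists>B. \<forall>n. (\<Sum>i<n. c * Y i \<omega> - (c * \<mu> + inverse (Suc k))) \<le> B"
    by (subst AE_all_countable, intro allI AE_ball_countable[THEN iffD2] ballI bnd) (auto simp: \<mu>_def)
  then show ?thesis
  proof eventually_elim
    case (elim \<omega>)
    show ?case
    proof (rule LIMSEQ_I)
      fix e :: real assume "0 < e"
      then obtain k where k: "inverse (real (Suc k)) < e / 2"
        using reals_Archimedean[of "e / 2"] by auto
      obtain B1 where B1: "\<And>n. (\<Sum>i<n. 1 * Y i \<omega> - (1 * \<mu> + inverse (Suc k))) \<le> B1"
        using elim by blast
      obtain B2 where B2: "\<And>n. (\<Sum>i<n. - 1 * Y i \<omega> - (- 1 * \<mu> + inverse (Suc k))) \<le> B2"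
        using elim by blast
      define B where "B = max B1 B2"
      obtain n0 :: nat where n0: "2 * \<bar>B\<bar> / e < n0" using reals_Archimedean2 by blast
      show "\<exists>n0. \<forall>n\<ge>n0. norm ((\<Sum>i<n. Y i \<omega>) / n - expectation (Y 0)) < e"
      proof (intro exI[of _ "Suc n0"] allI impI)
        fix n assume n: "Suc n0 \<le> n"
        then have "2 * \<bar>B\<bar> / e < n" using n0 by linarith
        then have Bn: "B < n * (e / 2)" using \<open>0 < e\<close> by (simp add: field_simps)
        have kn: "n * inverse (real (Suc k)) \<le> n * (e / 2)"
          using k by (intro mult_left_mono) auto
        have S: "(\<Sum>i<n. c * Y i \<omega> - d) = c * (\<Sum>i<n. Y i \<omega>) - n * d" for c d :: real
          by (simp add: sum_subtractf sum_distrib_left)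
        have "(\<Sum>i<n. Y i \<omega>) - n * \<mu> < n * e"
          using B1[of n] Bn kn unfolding S by (simp add: B_def algebra_simps)
        moreover have "n * \<mu> - (\<Sum>i<n. Y i \<omega>) < n * e"
          using B2[of n] Bn kn unfolding S by (simp add: B_def algebra_simps)
        ultimately have "\<bar>(\<Sum>i<n. Y i \<omega>) - n * \<mu>\<bar> < n * e" by linarith
        moreover have "(\<Sum>i<n. Y i \<omega>) / n - \<mu> = ((\<Sum>i<n. Y i \<omega>) - n * \<mu>) / n"
          using n by (simp add: field_simps)
        ultimately show "norm ((\<Sum>i<n. Y i \<omega>) / n - expectation (Y 0)) < e"
          using n by (simp add: \<mu>_def[symmetric] field_simps)
      qed
    qed
  qed
qed

end

section \<open>The uniform law of large numbers\<close>

text \<open>Allows suprema over \<open>U\<close>, possibly not measurable, to be replaced by suprema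
  over a countable dense subset. The open set \<open>O'\<close> localizes the bound to a
  ball.\<close>

lemma dense_bound:
  fixes g :: "'u::metric_space \<Rightarrow> real"
  assumes g: "continuous_on U g" and D: "U \<subseteq> closure D" "D \<subseteq> U" and "open O'"
    and bound: "\<And>v. v \<in> D \<Longrightarrow> v \<in> O' \<Longrightarrow> g v \<le> c" and v: "v \<in> U" "v \<in> O'"
  shows "g v \<le> c"
proof (rule ccontr)
  assume "\<not> g v \<le> c"
  then obtain d where d: "d > 0" "\<And>w. w \<in> U \<Longrightarrow> dist w v < d \<Longrightarrow> dist (g w) (g v) < g v - c"
    using g v(1) unfolding continuous_on_iff by (meson diff_gt_0_iff_gt not_le)
  obtain e where e: "e > 0" "\<And>w. dist w v < e \<Longrightarrow> w \<in> O'"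
    using \<open>open O'\<close> v(2) unfolding open_dist by blast
  obtain w where "w \<in> D" "dist w v < min d e"
    using D(1) v(1) d(1) e(1) closure_approachable[of v D] by (meson min_less_iff_conj subsetD)
  then show False
    using d(2)[of w] e(2)[of w] bound[of w] D(2) by (auto simp: dist_real_def)
qed

lemma jointly_measurable_section:
  fixes f :: "'u::topological_space \<Rightarrow> 'x::topological_space \<Rightarrow> real"
  assumes "(\<lambda>(u, x). f u x) \<in> borel_measurable borel"
  shows "f u \<in> borel_measurable borel"
proof -
  have "(\<lambda>x. (u, x)) \<in> borel_measurable borel"
    by (intro borel_measurable_continuous_onI continuous_intros)
  from measurable_compose[OF this assms] show ?thesis by simp
qed

text \<open>The transfer would be immediate if the bad points \<open>x\<close> formed a Borel set,
  but they are only the projection of a Borel set \<open>B\<close>. A closed set of bad points is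
  almost surely avoided by \<open>X\<close>, hence null for its law, and
  \<open>projection_null\<close> extends this to all bad points.\<close>

lemma AE_continuous_on_from_pullback:
  fixes f :: "'u::{metric_space, second_countable_topology} \<Rightarrow> 'x::metric_space \<Rightarrow> real"
  assumes "finite_measure M" and X [measurable]: "X \<in> borel_measurable M" and U: "compact U"
    and f: "(\<lambda>(u, x). f u x) \<in> borel_measurable borel"
    and cont: "AE \<omega> in M. continuous_on U (\<lambda>u. f u (X \<omega>))"
  shows "AE x in distr M borel X. continuous_on U (\<lambda>u. f u x)"
proof -
  interpret finite_measure M by fact
  obtain D where D: "countable D" "D \<subseteq> U" "U \<subseteq> closure D" using separable[of U] by blast
  define E where "E k n v = {p. dist (fst p) v < inverse (Suc n) \<and>
      inverse (Suc k) \<le> \<bar>f v (snd p) - f (fst p) (snd p)\<bar>}" for k n :: nat and v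
  \<comment> \<open>\<open>(u, x) \<in> B\<close> iff \<open>f v x\<close> does not tend to \<open>f u x\<close> as \<open>v\<close> tends to \<open>u\<close> within \<open>D\<close>.\<close>
  define B where "B = (\<Union>k. \<Inter>n. \<Union>v\<in>D. E k n v)"
  have B_iff: "(u, x) \<in> B \<longleftrightarrow> (\<exists>k::nat. \<forall>n::nat. \<exists>v\<in>D. dist u v < inverse (Suc n) \<and>
      inverse (Suc k) \<le> \<bar>f v x - f u x\<bar>)" for u x
    by (simp add: B_def E_def)
  have [measurable]: "E k n v \<in> sets borel" for k n v
  proof -
    have [measurable]: "(\<lambda>p::'u \<times> 'x. dist (fst p) v) \<in> borel_measurable borel"
      by (intro borel_measurable_continuous_onI continuous_intros)
    have "(\<lambda>p::'u \<times> 'x. (v, snd p)) \<in> borel_measurable borel"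
      by (intro borel_measurable_continuous_onI continuous_intros)
    from measurable_compose[OF this f]
    have [measurable]: "(\<lambda>p::'u \<times> 'x. f v (snd p)) \<in> borel_measurable borel" by simp
    have [measurable]: "(\<lambda>p::'u \<times> 'x. f (fst p) (snd p)) \<in> borel_measurable borel"
      using f by (simp add: split_beta')
    have "{p\<in>space borel. dist (fst p) v < inverse (Suc n) \<and>
      inverse (Suc k) \<le> \<bar>f v (snd p) - f (fst p) (snd p)\<bar>} \<in> sets borel" by measurable
    then show ?thesis by (simp add: E_def)
  qed
  have B: "B \<in> sets borel"
    unfolding B_def by (intro sets.countable_UN sets.countable_INT sets.countable_UN'' D image_subsetI) auto
  have discont: "(u, x) \<notin> B" if u: "u \<in> U" and c: "continuous_on U (\<lambda>u. f u x)" for u x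
  proof
    assume "(u, x) \<in> B"
    then obtain k :: nat where k: "\<And>n::nat. \<exists>v\<in>D. dist u v < inverse (Suc n) \<and>
      inverse (Suc k) \<le> \<bar>f v x - f u x\<bar>"
      unfolding B_iff by blast
    obtain d where d: "d > 0" "\<And>v. v \<in> U \<Longrightarrow> dist v u < d \<Longrightarrow> dist (f v x) (f u x) < inverse (Suc k)"
      using c[unfolded continuous_on_iff, rule_format, OF u, of "inverse (real (Suc k))"] by auto
    obtain n where "inverse (real (Suc n)) < d" using reals_Archimedean[OF d(1)] by blast
    moreover obtain v where "v \<in> D" "dist u v < inverse (Suc n)" "inverse (Suc k) \<le> \<bar>f v x - f u x\<bar>"
      using k by blast
    ultimately show False
      using d(2)[of v] D(2) by (auto simp: dist_commute dist_real_def)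
  qed
  have cont_iff: "continuous_on U (\<lambda>u. f u x)" if B: "\<forall>u\<in>U. (u, x) \<notin> B" for x
    unfolding continuous_on_iff
  proof (intro ballI allI impI)
    have near: "\<exists>d>0. \<forall>v\<in>D. dist u v < d \<longrightarrow> \<bar>f v x - f u x\<bar> < e" if "u \<in> U" "e > 0" for u e
    proof -
      obtain k where k: "inverse (real (Suc k)) < e" using reals_Archimedean[OF \<open>e > 0\<close>] by blast
      have "\<not> (\<forall>n::nat. \<exists>v\<in>D. dist u v < inverse (Suc n) \<and> inverse (Suc k) \<le> \<bar>f v x - f u x\<bar>)"
        using B \<open>u \<in> U\<close> unfolding B_iff by blast
      then obtain n :: nat where "\<And>v. v \<in> D \<Longrightarrow> dist u v < inverse (Suc n) \<Longrightarrow> \<bar>f v x - f u x\<bar> < inverse (Suc k)"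
        using not_le by blast
      moreover have "0 < inverse (real (Suc n))" by simp
      ultimately show ?thesis using k by (meson less_trans)
    qed
    fix u and e :: real assume "u \<in> U" "0 < e"
    then obtain d where d: "d > 0" "\<forall>v\<in>D. dist u v < d \<longrightarrow> \<bar>f v x - f u x\<bar> < e / 2"
      using near[of u "e / 2"] by auto
    have "dist (f w x) (f u x) < e" if "w \<in> U" and w: "dist w u < d" for w
    proof -
      obtain d' where d': "d' > 0" "\<forall>v\<in>D. dist w v < d' \<longrightarrow> \<bar>f v x - f w x\<bar> < e / 2"
        using near[of w "e / 2"] \<open>0 < e\<close> \<open>w \<in> U\<close> by auto
      \<comment> \<open>Points \<open>w\<close> and \<open>u\<close> are compared through a point of
        \<open>D\<close> close to \<open>w\<close>; the slack \<open>d - dist w u\<close> keeps it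
        within \<open>d\<close> of \<open>u\<close>.\<close>
      obtain v where v: "v \<in> D" "dist v w < min d' (d - dist w u)"
        using D(3) \<open>w \<in> U\<close> closure_approachable[THEN iffD1, rule_format, of w D "min d' (d - dist w u)"] d'(1) w
        by auto
      moreover have "dist u v < d"
        using v(2) dist_triangle[of u v w] by (simp add: dist_commute)
      ultimately have "\<bar>f v x - f w x\<bar> < e / 2" "\<bar>f v x - f u x\<bar> < e / 2"
        using d(2) d'(2) by (auto simp: dist_commute)
      then show ?thesis unfolding dist_real_def by linarith
    qed
    then show "\<exists>d>0. \<forall>w\<in>U. dist w u < d \<longrightarrow> dist (f w x) (f u x) < e"
      using d(1) by blast
  qed
  have "AE x in distr M borel X. \<forall>u\<in>U. (u, x) \<notin> B"
  proof (rule projection_null[OF _ _ U B])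
    show "finite_measure (distr M borel X)" by (rule finite_measure_distr) simp
    fix T :: "'x set" assume T: "closed T" "\<And>x. x \<in> T \<Longrightarrow> \<exists>u\<in>U. (u, x) \<in> B"
    have "AE \<omega> in M. X \<omega> \<notin> T"
      using cont by eventually_elim (use T(2) discont in blast)
    then have "AE x in distr M borel X. x \<notin> T"
      using T(1) by (subst AE_distr_iff) (auto simp: Collect_neg_eq intro: borel_comp borel_closed)
    then show "emeasure (distr M borel X) T = 0"
      using T(1) by (subst (asm) AE_iff_measurable[OF _ refl]) (auto simp: borel_closed)
  qed simp
  then show ?thesis by eventually_elim (rule cont_iff)
qed

text \<open>The supremum over a countable dense \<open>D\<close> is measurable and lies below the
  one in \<open>dom\<close>, so its integral is finite; continuity extends the resulting bound from
  \<open>D\<close> to \<open>U\<close>.\<close>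

lemma integrable_envelope:
  fixes f :: "'u::{metric_space, second_countable_topology} \<Rightarrow> 'x::metric_space \<Rightarrow> real"
  assumes X [measurable]: "X \<in> borel_measurable M"
    and f: "(\<lambda>(u, x). f u x) \<in> borel_measurable borel"
    and cont: "AE x in distr M borel X. continuous_on U (\<lambda>u. f u x)"
    and dom: "(\<integral>\<^sup>+ \<omega>. (SUP u\<in>U. ennreal \<bar>f u (X \<omega>)\<bar>) \<partial>M) < \<infinity>"
  obtains F where "integrable (distr M borel X) F" "AE x in distr M borel X. \<forall>u\<in>U. \<bar>f u x\<bar> \<le> F x"
proof -
  obtain D where D: "countable D" "D \<subseteq> U" "U \<subseteq> closure D" using separable[of U] by blast
  note [measurable] = jointly_measurable_section[OF f] and [simp] = D(1)
  define G where "G x = (SUP v\<in>D. ennreal \<bar>f v x\<bar>)" for x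
  have [measurable]: "G \<in> borel_measurable borel" unfolding G_def by measurable
  have "(\<integral>\<^sup>+ x. G x \<partial>distr M borel X) = (\<integral>\<^sup>+ \<omega>. G (X \<omega>) \<partial>M)"
    by (rule nn_integral_distr) auto
  also have "\<dots> \<le> (\<integral>\<^sup>+ \<omega>. (SUP u\<in>U. ennreal \<bar>f u (X \<omega>)\<bar>) \<partial>M)"
    unfolding G_def by (intro nn_integral_mono SUP_subset_mono D) auto
  also have "\<dots> < \<infinity>" by (rule dom)
  finally have fin: "(\<integral>\<^sup>+ x. G x \<partial>distr M borel X) < \<infinity>" .
  then have AE_fin: "AE x in distr M borel X. G x \<noteq> \<infinity>"
    by (intro nn_integral_noteq_infinite) auto
  have "(\<integral>\<^sup>+ x. ennreal (enn2real (G x)) \<partial>distr M borel X) \<le> (\<integral>\<^sup>+ x. G x \<partial>distr M borel X)"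
    by (intro nn_integral_mono) (simp add: ennreal_enn2real_if)
  then have "integrable (distr M borel X) (\<lambda>x. enn2real (G x))"
    using fin by (intro integrableI_bounded) auto
  moreover have "AE x in distr M borel X. \<forall>u\<in>U. \<bar>f u x\<bar> \<le> enn2real (G x)"
    using AE_fin cont
  proof eventually_elim
    case (elim x)
    have "\<bar>f v x\<bar> \<le> enn2real (G x)" if "v \<in> D" for v
    proof -
      have "ennreal \<bar>f v x\<bar> \<le> G x" unfolding G_def using that by (rule SUP_upper)
      then show ?thesis using elim(1) enn2real_mono[of "ennreal \<bar>f v x\<bar>" "G x"] by (simp add: top.not_eq_extremum)
    qed
    moreover have "continuous_on U (\<lambda>u. \<bar>f u x\<bar>)" using elim(2) by (intro continuous_intros)
    ultimately show ?case
      using dense_bound[of U "\<lambda>u. \<bar>f u x\<bar>" D UNIV] D by auto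
  qed
  ultimately show ?thesis by (rule that)
qed

text \<open>The oscillation over a shrinking ball, taken along a countable dense set, tends to 0 by
  continuity and is dominated by \<open>2 * F\<close>, so its mean tends to 0.\<close>

lemma oscillation_in_mean:
  fixes f :: "'u::{metric_space, second_countable_topology} \<Rightarrow> 'x::metric_space \<Rightarrow> real"
  assumes sets [measurable_cong]: "sets \<mu> = sets borel"
    and f: "(\<lambda>(u, x). f u x) \<in> borel_measurable borel"
    and cont: "AE x in \<mu>. continuous_on U (\<lambda>u. f u x)"
    and F: "integrable \<mu> F" "AE x in \<mu>. \<forall>u\<in>U. \<bar>f u x\<bar> \<le> F x"
    and u: "u \<in> U" and "0 < e"
  obtains h r where "integrable \<mu> h" "integral\<^sup>L \<mu> h < e" "0 < r"
    "AE x in \<mu>. \<forall>v\<in>U \<inter> ball u r. \<bar>f v x - f u x\<bar> \<le> h x"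
proof -
  obtain D where D: "countable D" "D \<subseteq> U" "U \<subseteq> closure D" using separable[of U] by blast
  note [measurable] = jointly_measurable_section[OF f]
  let ?D = "\<lambda>n. D \<inter> ball u (inverse (real (Suc n)))"
  define G where "G n x = (SUP v\<in>?D n. ennreal \<bar>f v x - f u x\<bar>)" for n x
  have [measurable]: "G n \<in> borel_measurable borel" for n
    unfolding G_def by (intro borel_measurable_SUP countable_Int1 D(1)) measurable
  \<comment> \<open>Here an infinite supremum becomes 0; the bound by \<open>2 * F\<close> confines
    this to a null set.\<close>
  define h where "h n x = enn2real (G n x)" for n x
  have [measurable]: "h n \<in> borel_measurable borel" for n unfolding h_def by measurable
  have G_le: "G n x \<le> ennreal c" if "\<And>v. v \<in> ?D n \<Longrightarrow> \<bar>f v x - f u x\<bar> \<le> c" for n x c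
    unfolding G_def by (intro SUP_least ennreal_leI that)
  have F2: "AE x in \<mu>. \<forall>v\<in>U. \<bar>f v x - f u x\<bar> \<le> 2 * F x"
    using F(2)
  proof eventually_elim
    case (elim x)
    show ?case
    proof
      fix v assume "v \<in> U"
      then have "\<bar>f v x\<bar> \<le> F x" "\<bar>f u x\<bar> \<le> F x" using elim u by auto
      then show "\<bar>f v x - f u x\<bar> \<le> 2 * F x" by linarith
    qed
  qed
  have h_le: "AE x in \<mu>. norm (h n x) \<le> 2 * F x" for n
    using F2
  proof eventually_elim
    case (elim x)
    have "0 \<le> 2 * F x" using elim u by force
    moreover have "G n x \<le> ennreal (2 * F x)" using elim D(2) by (intro G_le) auto
    ultimately show ?case unfolding h_def by (simp add: enn2real_leI)
  qed
  have int_h: "integrable \<mu> (h n)" for n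
    by (rule Bochner_Integration.integrable_bound[of _ "\<lambda>x. 2 * F x"]) (use F(1) h_le[of n] in auto)
  have "AE x in \<mu>. (\<lambda>n. h n x) \<longlonglongrightarrow> 0"
    using cont
  proof eventually_elim
    case (elim x)
    show ?case
    proof (rule LIMSEQ_I)
      fix e :: real assume "0 < e"
      then obtain d where d: "d > 0" "\<And>v. v \<in> U \<Longrightarrow> dist v u < d \<Longrightarrow> dist (f v x) (f u x) < e / 2"
        using elim u unfolding continuous_on_iff by (meson half_gt_zero)
      obtain n0 where n0: "inverse (real (Suc n0)) < d" using reals_Archimedean[OF d(1)] by blast
      have "norm (h n x - 0) < e" if n: "n0 \<le> n" for n
      proof -
        have "inverse (real (Suc n)) \<le> inverse (real (Suc n0))" using n by simp
        then have "inverse (real (Suc n)) < d" using n0 by linarith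
        then have "G n x \<le> ennreal (e / 2)"
          using d(2) D(2) by (intro G_le) (force simp: dist_commute dist_real_def)
        then have "h n x \<le> e / 2" unfolding h_def using \<open>0 < e\<close> by (intro enn2real_leI) auto
        moreover have "0 \<le> h n x" by (simp add: h_def)
        ultimately show ?thesis using \<open>0 < e\<close> by simp
      qed
      then show "\<exists>n0. \<forall>n\<ge>n0. norm (h n x - 0) < e" by blast
    qed
  qed
  then have "(\<lambda>n. integral\<^sup>L \<mu> (h n)) \<longlonglongrightarrow> integral\<^sup>L \<mu> (\<lambda>_. 0)"
    using F(1) h_le by (intro integral_dominated_convergence[where w = "\<lambda>x. 2 * F x"]) auto
  then have "\<forall>\<^sub>F n in sequentially. integral\<^sup>L \<mu> (h n) < e"
    using \<open>0 < e\<close> by (auto dest: order_tendstoD(2))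
  then obtain n where n: "integral\<^sup>L \<mu> (h n) < e" by (auto simp: eventually_sequentially)
  have "AE x in \<mu>. \<forall>v\<in>U \<inter> ball u (inverse (real (Suc n))). \<bar>f v x - f u x\<bar> \<le> h n x"
    using F2 cont
  proof eventually_elim
    case (elim x)
    have "G n x \<le> ennreal (2 * F x)" using elim D(2) by (intro G_le) auto
    then have fin: "G n x < top" by (rule le_less_trans) simp
    have "\<bar>f v x - f u x\<bar> \<le> h n x" if "v \<in> D" "v \<in> ball u (inverse (real (Suc n)))" for v
    proof -
      have "ennreal \<bar>f v x - f u x\<bar> \<le> G n x" unfolding G_def using that by (intro SUP_upper) auto
      then show ?thesis
        using fin enn2real_mono[of "ennreal \<bar>f v x - f u x\<bar>" "G n x"] by (simp add: h_def)
    qed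
    moreover have "continuous_on U (\<lambda>v. \<bar>f v x - f u x\<bar>)" using elim(2) by (intro continuous_intros)
    ultimately show ?case
      using dense_bound[of U "\<lambda>v. \<bar>f v x - f u x\<bar>" D "ball u (inverse (real (Suc n)))"] D by auto
  qed
  then show ?thesis by (intro that[OF int_h n, of "inverse (real (Suc n))"]) auto
qed

section \<open>Averages over an i.i.d. sample\<close>

locale iid_sample = prob_space M for M :: "'a measure" +
  fixes Xs :: "nat \<Rightarrow> 'a \<Rightarrow> 'x::{metric_space, second_countable_topology}" and \<mu> :: "'x measure"
  assumes meas: "\<And>j. 1 \<le> j \<Longrightarrow> Xs j \<in> borel_measurable M"
    and indep: "indep_vars (\<lambda>_. borel) Xs {1..}"
    and distr: "\<And>j. 1 \<le> j \<Longrightarrow> distr M borel (Xs j) = \<mu>"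
begin

lemma sets_mu [measurable_cong]: "sets \<mu> = sets borel"
  using distr[of 1] by auto

text \<open>Transfer from the law to the sample points needs no measurability of \<open>P\<close>,
  so it applies to continuity and to bounds over uncountable sets.\<close>

lemma AE_sample:
  assumes "AE x in \<mu>. P x"
  shows "AE \<omega> in M. \<forall>j\<ge>1. P (Xs j \<omega>)"
proof -
  have "AE \<omega> in M. P (Xs j \<omega>)" if "1 \<le> j" for j
    by (rule AE_distrD[OF meas[OF that] assms[folded distr[OF that]]])
  then show ?thesis
    by (subst AE_all_countable) auto
qed

lemma sample_mean_tendsto:
  assumes [measurable]: "\<phi> \<in> borel_measurable borel" and int: "integrable \<mu> (\<phi> :: 'x \<Rightarrow> real)"
  shows "AE \<omega> in M. (\<lambda>N. (\<Sum>j=1..N. \<phi> (Xs j \<omega>)) / real N) \<longlonglongrightarrow> integral\<^sup>L \<mu> \<phi>"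
proof -
  have [measurable]: "Xs (Suc i) \<in> borel_measurable M" for i by (rule meas) simp
  have \<mu>: "distr M borel (Xs (Suc i)) = \<mu>" for i by (rule distr) simp
  \<comment> \<open>The sample is indexed from 1, the strong law from 0.\<close>
  have "range Suc = {1..}" by (auto simp: image_iff Suc_le_eq gr0_conv_Suc)
  then have "indep_vars (\<lambda>_. borel) (\<lambda>i. Xs (Suc i)) UNIV"
    using indep_vars_reindex[of Suc UNIV "\<lambda>_. borel" Xs] indep by simp
  then have "indep_vars (\<lambda>_. borel) (\<lambda>i \<omega>. \<phi> (Xs (Suc i) \<omega>)) UNIV"
    by (rule indep_vars_compose2) simp
  moreover have "distr M borel (\<lambda>\<omega>. \<phi> (Xs (Suc i) \<omega>)) = distr \<mu> borel \<phi>" for i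
    unfolding \<mu>[of i, symmetric] by (simp add: distr_distr o_def)
  moreover have "integrable M (\<lambda>\<omega>. \<phi> (Xs (Suc 0) \<omega>))"
    using int unfolding \<mu>[of 0, symmetric] by (subst (asm) integrable_distr_eq) auto
  moreover have "expectation (\<lambda>\<omega>. \<phi> (Xs (Suc 0) \<omega>)) = integral\<^sup>L \<mu> \<phi>"
    unfolding \<mu>[of 0, symmetric] by (subst integral_distr) auto
  ultimately show ?thesis
    using strong_law_of_large_numbers[of "\<lambda>i \<omega>. \<phi> (Xs (Suc i) \<omega>)"]
    by (simp add: sum.atLeast1_atMost_eq)
qed

text \<open>A finite cover by balls with oscillation of mean below \<open>e\<close> leaves three
  errors: the oscillation in the sample average, the oscillation in the mean, and the deviation at
  the centre. The strong law at finitely many functions controls the first and the last.\<close>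

theorem uniform_law_of_large_numbers:
  fixes f :: "'u::{metric_space, second_countable_topology} \<Rightarrow> 'x \<Rightarrow> real"
  assumes U: "compact U"
    and f: "(\<lambda>(u, x). f u x) \<in> borel_measurable borel"
    and cont: "AE x in \<mu>. continuous_on U (\<lambda>u. f u x)"
    and F: "integrable \<mu> F" "AE x in \<mu>. \<forall>u\<in>U. \<bar>f u x\<bar> \<le> F x"
  shows "AE \<omega> in M. uniform_limit U (\<lambda>N u. (\<Sum>j=1..N. f u (Xs j \<omega>)) / real N)
      (\<lambda>u. integral\<^sup>L \<mu> (f u)) sequentially"
proof -
  note f_meas = jointly_measurable_section[OF f]
  note [measurable] = f_meas
  have int_f: "integrable \<mu> (f u)" if "u \<in> U" for u
  proof (rule Bochner_Integration.integrable_bound[OF F(1)])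
    show "AE x in \<mu>. norm (f u x) \<le> norm (F x)"
      using F(2) by eventually_elim (use that in fastforce)
  qed simp
  have step: "AE \<omega> in M. \<forall>\<^sub>F N in sequentially.
      \<forall>v\<in>U. \<bar>(\<Sum>j=1..N. f v (Xs j \<omega>)) / real N - integral\<^sup>L \<mu> (f v)\<bar> < 3 * e" if "0 < e" for e
  proof -
    let ?Q = "\<lambda>u p. integrable \<mu> (fst p) \<and> integral\<^sup>L \<mu> (fst p) < e \<and> 0 < snd p \<and>
      (AE x in \<mu>. \<forall>v\<in>U \<inter> ball u (snd p). \<bar>f v x - f u x\<bar> \<le> fst p x)"
    have "\<forall>u\<in>U. \<exists>p. ?Q u p"
    proof
      fix u assume "u \<in> U"
      from oscillation_in_mean[OF sets_mu f cont F this \<open>0 < e\<close>]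
      obtain h r where "integrable \<mu> h" "integral\<^sup>L \<mu> h < e" "0 < r"
        "AE x in \<mu>. \<forall>v\<in>U \<inter> ball u r. \<bar>f v x - f u x\<bar> \<le> h x" .
      then show "\<exists>p. ?Q u p" by (intro exI[of _ "(h, r)"]) simp
    qed
    from bchoice[OF this] obtain p where p: "\<forall>u\<in>U. ?Q u (p u)" ..
    define h r where "h u = fst (p u)" and "r u = snd (p u)" for u
    have h: "\<And>u. u \<in> U \<Longrightarrow> integrable \<mu> (h u)" "\<And>u. u \<in> U \<Longrightarrow> integral\<^sup>L \<mu> (h u) < e"
      and r: "\<And>u. u \<in> U \<Longrightarrow> 0 < r u"
      and osc: "\<And>u. u \<in> U \<Longrightarrow> AE x in \<mu>. \<forall>v\<in>U \<inter> ball u (r u). \<bar>f v x - f u x\<bar> \<le> h u x"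
      using p unfolding h_def r_def by blast+
    have "h u \<in> borel_measurable borel" if "u \<in> U" for u
      using borel_measurable_integrable[OF h(1)[OF that]] sets_mu by (simp cong: measurable_cong_sets)
    note h_meas = this
    obtain C where C: "C \<subseteq> U" "finite C" "U \<subseteq> (\<Union>u\<in>C. ball u (r u))"
      using compactE_image[OF U, of U "\<lambda>u. ball u (r u)"] r by force
    have "AE \<omega> in M. \<forall>u\<in>C. \<forall>j\<ge>1. \<forall>v\<in>U \<inter> ball u (r u). \<bar>f v (Xs j \<omega>) - f u (Xs j \<omega>)\<bar> \<le> h u (Xs j \<omega>)"
      by (rule AE_finite_allI[OF C(2)], rule AE_sample, rule osc) (use C(1) in blast)
    moreover have "AE \<omega> in M. \<forall>u\<in>C. (\<lambda>N. (\<Sum>j=1..N. h u (Xs j \<omega>)) / real N) \<longlonglongrightarrow> integral\<^sup>L \<mu> (h u)"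
      by (rule AE_finite_allI[OF C(2)], rule sample_mean_tendsto) (use C(1) h h_meas in auto)
    moreover have "AE \<omega> in M. \<forall>u\<in>C. (\<lambda>N. (\<Sum>j=1..N. f u (Xs j \<omega>)) / real N) \<longlonglongrightarrow> integral\<^sup>L \<mu> (f u)"
      by (rule AE_finite_allI[OF C(2)], rule sample_mean_tendsto) (use C(1) int_f f_meas in auto)
    ultimately show ?thesis
    proof eventually_elim
      case (elim \<omega>)
      have "\<forall>\<^sub>F N in sequentially. \<forall>u\<in>C. (\<Sum>j=1..N. h u (Xs j \<omega>)) / real N < e"
        using elim(2) h(2) C by (intro eventually_ball_finite ballI order_tendstoD(2)) auto
      moreover have "\<forall>\<^sub>F N in sequentially. \<forall>u\<in>C. dist ((\<Sum>j=1..N. f u (Xs j \<omega>)) / real N) (integral\<^sup>L \<mu> (f u)) < e"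
        using elim(3) C \<open>0 < e\<close> by (intro eventually_ball_finite ballI tendstoD) auto
      ultimately show ?case
      proof eventually_elim
        case N: (elim N)
        show ?case
        proof
          fix v assume v: "v \<in> U"
          then obtain u where u: "u \<in> C" "v \<in> ball u (r u)" using C(3) by blast
          have uU: "u \<in> U" using u C(1) by blast
          have "\<bar>(\<Sum>j=1..N. f v (Xs j \<omega>)) / real N - (\<Sum>j=1..N. f u (Xs j \<omega>)) / real N\<bar>
              = \<bar>\<Sum>j=1..N. f v (Xs j \<omega>) - f u (Xs j \<omega>)\<bar> / real N"
            by (simp add: sum_subtractf diff_divide_distrib[symmetric])
          also have "\<dots> \<le> (\<Sum>j=1..N. h u (Xs j \<omega>)) / real N"
            using elim(1) u v
            by (intro divide_right_mono order_trans[OF sum_abs] sum_mono) auto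
          also have "\<dots> < e" using N(1) u by blast
          finally have 1: "\<bar>(\<Sum>j=1..N. f v (Xs j \<omega>)) / real N - (\<Sum>j=1..N. f u (Xs j \<omega>)) / real N\<bar> < e" .
          have "\<bar>integral\<^sup>L \<mu> (f v) - integral\<^sup>L \<mu> (f u)\<bar> = \<bar>integral\<^sup>L \<mu> (\<lambda>x. f v x - f u x)\<bar>"
            using int_f v uU by simp
          also have "\<dots> \<le> integral\<^sup>L \<mu> (\<lambda>x. \<bar>f v x - f u x\<bar>)"
            by (rule integral_abs_bound)
          also have "\<dots> \<le> integral\<^sup>L \<mu> (h u)"
          proof (rule integral_mono_AE)
            show "AE x in \<mu>. \<bar>f v x - f u x\<bar> \<le> h u x"
              using osc[OF uU] by eventually_elim (use u(2) v in blast)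
          qed (use int_f v uU h(1) in auto)
          also have "\<dots> < e" by (rule h(2)[OF uU])
          finally have 2: "\<bar>integral\<^sup>L \<mu> (f v) - integral\<^sup>L \<mu> (f u)\<bar> < e" .
          have 3: "\<bar>(\<Sum>j=1..N. f u (Xs j \<omega>)) / real N - integral\<^sup>L \<mu> (f u)\<bar> < e"
            using N(2) u by (simp add: dist_real_def)
          show "\<bar>(\<Sum>j=1..N. f v (Xs j \<omega>)) / real N - integral\<^sup>L \<mu> (f v)\<bar> < 3 * e"
            using 1 2 3 by linarith
        qed
      qed
    qed
  qed
  have "AE \<omega> in M. \<forall>k::nat. \<forall>\<^sub>F N in sequentially.
      \<forall>v\<in>U. \<bar>(\<Sum>j=1..N. f v (Xs j \<omega>)) / real N - integral\<^sup>L \<mu> (f v)\<bar> < 3 * inverse (Suc k)"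
    by (subst AE_all_countable, intro allI step) simp
  then show ?thesis
  proof eventually_elim
    case (elim \<omega>)
    show ?case
      unfolding uniform_limit_iff
    proof (intro allI impI)
      fix e :: real assume "0 < e"
      then obtain k where k: "inverse (real (Suc k)) < e / 3"
        using reals_Archimedean[of "e / 3"] by auto
      from elim[rule_format, of k]
      show "\<forall>\<^sub>F N in sequentially. \<forall>v\<in>U.
          dist ((\<Sum>j=1..N. f v (Xs j \<omega>)) / real N) (integral\<^sup>L \<mu> (f v)) < e"
        by eventually_elim (use k in \<open>force simp: dist_real_def\<close>)
    qed
  qed
qed

end

section \<open>Stability of constrained minimization\<close>

text \<open>Deterministic, to be applied path by path. Strictly feasible points near an optimum
  survive perturbation of the constraint, which bounds the values from above; compactness separates
  infeasible or suboptimal points by a margin, which bounds them from below and localizes the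
  minimizers.\<close>

lemma argmin_stability:
  fixes f g :: "'u::metric_space \<Rightarrow> real"
  assumes U: "compact U"
    and fs_lim: "uniform_limit U fs f sequentially" and gs_lim: "uniform_limit U gs g sequentially"
    and cont_s: "\<forall>\<^sub>F N in sequentially. continuous_on U (fs N) \<and> continuous_on U (gs N)"
    and ne: "{u\<in>U. g u \<le> K} \<noteq> {}"
    and slater: "{u\<in>U. g u \<le> K} \<subseteq> closure {u\<in>U. g u < K}"
  shows "(\<lambda>N. infval (fs N) {u\<in>U. gs N u \<le> K}) \<longlonglongrightarrow> infval f {u\<in>U. g u \<le> K}"
    and "(\<lambda>N. devD (argminset (fs N) {u\<in>U. gs N u \<le> K}) (argminset f {u\<in>U. g u \<le> K})) \<longlonglongrightarrow> 0"
proof -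
  have f: "continuous_on U f" and g: "continuous_on U g"
    using cont_s by (auto intro: uniform_limit_theorem[OF _ fs_lim] uniform_limit_theorem[OF _ gs_lim] elim: eventually_mono)
  let ?A = "{u\<in>U. g u \<le> K}" and ?AN = "\<lambda>N. {u\<in>U. gs N u \<le> K}"
  have sublevel: "compact {u\<in>U. h u \<le> c}" if "continuous_on U h" for h :: "'u \<Rightarrow> real" and c
  proof -
    have "closed (U \<inter> h -` {..c})"
      using that compact_imp_closed[OF U] by (intro continuous_closed_preimage) auto
    then have "compact (U \<inter> (U \<inter> h -` {..c}))" using U by (rule compact_Int_closed[rotated])
    moreover have "U \<inter> (U \<inter> h -` {..c}) = {u\<in>U. h u \<le> c}" by auto
    ultimately show ?thesis by simp
  qed
  have attain: "\<exists>u\<in>S. \<forall>u'\<in>S. h u \<le> h u'" if "compact S" "S \<noteq> {}" "continuous_on S h" for S and h :: "'u \<Rightarrow> real"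
    using continuous_attains_inf[OF that] .
  have infval_eq: "infval h S = ereal (h u)" if "u \<in> S" "\<forall>u'\<in>S. h u \<le> h u'" for h :: "'u \<Rightarrow> real" and S u
    unfolding infval_def using that by (intro antisym INF_lower INF_greatest) auto
  obtain u0 where u0: "u0 \<in> ?A" "\<And>u. u \<in> ?A \<Longrightarrow> f u0 \<le> f u"
    using attain[OF sublevel[OF g] ne continuous_on_subset[OF f]] by blast
  define v where "v = f u0"
  \<comment> \<open>On a compact set of points that are infeasible or not optimal, \<open>max (g - K) (f - v)\<close> has a positive minimum.\<close>
  have gap: "\<exists>d>0. \<forall>u\<in>W. g u \<ge> K + d \<or> f u \<ge> v + d"
    if "compact W" "W \<subseteq> U" "\<And>u. u \<in> W \<Longrightarrow> g u > K \<or> f u > v" for W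
  proof (cases "W = {}")
    case False
    have "continuous_on W (\<lambda>u. max (g u - K) (f u - v))"
      using that(2) by (intro continuous_intros continuous_on_subset[OF f] continuous_on_subset[OF g])
    from attain[OF that(1) False this] obtain w where w: "w \<in> W"
      "\<And>u. u \<in> W \<Longrightarrow> max (g w - K) (f w - v) \<le> max (g u - K) (f u - v)" by blast
    let ?d = "max (g w - K) (f w - v)"
    have "?d > 0" using that(3)[OF w(1)] by (auto simp: less_max_iff_disj)
    moreover have "g u \<ge> K + ?d \<or> f u \<ge> v + ?d" if "u \<in> W" for u
      using w(2)[OF that] by (simp add: le_max_iff_disj) linarith
    ultimately show ?thesis by blast
  qed (auto intro: exI[of _ 1])
  have close: "\<forall>\<^sub>F N in sequentially. \<forall>u\<in>U. \<bar>fs N u - f u\<bar> < e \<and> \<bar>gs N u - g u\<bar> < e" if "0 < e" for e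
    using fs_lim[unfolded uniform_limit_iff, rule_format, OF that] gs_lim[unfolded uniform_limit_iff, rule_format, OF that]
    by eventually_elim (simp add: dist_real_def)
  have upper: "\<forall>\<^sub>F N in sequentially. \<exists>u\<in>?AN N. fs N u < v + e" if "0 < e" for e
  proof -
    have "u0 \<in> U" using u0(1) by simp
    then obtain d where d: "d > 0" "\<And>u. u \<in> U \<Longrightarrow> dist u u0 < d \<Longrightarrow> dist (f u) (f u0) < e / 2"
      using f \<open>0 < e\<close> unfolding continuous_on_iff by (meson half_gt_zero)
    \<comment> \<open>The optimum \<open>u0\<close> may lie on the boundary \<open>g = K\<close> and
      become infeasible for \<open>gs N\<close>; the nearby strictly feasible \<open>u1\<close>
      eventually stays feasible.\<close>
    obtain u1 where u1: "u1 \<in> U" "g u1 < K" "dist u1 u0 < d"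
      using slater u0(1) d(1) closure_approachable[of u0 "{u\<in>U. g u < K}"] by blast
    have fu1: "f u1 < v + e / 2" using d(2)[OF u1(1,3)] unfolding v_def dist_real_def by linarith
    have "0 < min (e / 2) (K - g u1)" using u1(2) \<open>0 < e\<close> by simp
    from close[OF this] show ?thesis
    proof eventually_elim
      case (elim N)
      then have "\<bar>fs N u1 - f u1\<bar> < min (e / 2) (K - g u1)" "\<bar>gs N u1 - g u1\<bar> < min (e / 2) (K - g u1)"
        using u1(1) by auto
      then have "fs N u1 < v + e" "gs N u1 \<le> K" using fu1 by linarith+
      then show ?case using u1(1) by blast
    qed
  qed
  have lower: "\<forall>\<^sub>F N in sequentially. \<forall>u\<in>?AN N. v - e < fs N u" if "0 < e" for e
  proof -
    \<comment> \<open>Points with value well below \<open>v\<close> violate the constraint by a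
      uniform margin, so they are eventually infeasible for \<open>gs N\<close> too.\<close>
    let ?W = "{u\<in>U. f u \<le> v - e / 2}"
    have "g u > K" if "u \<in> ?W" for u
      using that u0(2)[of u] \<open>0 < e\<close> by (force simp: v_def not_less)
    with gap[OF sublevel[OF f], of "v - e / 2"]
    obtain d where d: "d > 0" "\<And>u. u \<in> ?W \<Longrightarrow> g u \<ge> K + d \<or> f u \<ge> v + d" by blast
    have "0 < min (e / 2) d" using d(1) \<open>0 < e\<close> by simp
    from close[OF this] show ?thesis
    proof eventually_elim
      case (elim N)
      show ?case
      proof
        fix u assume u: "u \<in> ?AN N"
        then have 1: "\<bar>fs N u - f u\<bar> < min (e / 2) d" "\<bar>gs N u - g u\<bar> < min (e / 2) d" using elim by auto
        show "v - e < fs N u"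
        proof (cases "u \<in> ?W")
          case True
          then have "g u \<ge> K + d \<or> f u \<ge> v + d" "f u \<le> v - e / 2" using d(2) by auto
          moreover have "gs N u \<le> K" using u by simp
          ultimately show ?thesis using 1 d(1) \<open>0 < e\<close> by linarith
        next
          case False
          then have "f u > v - e / 2" using u by simp
          then show ?thesis using 1 by linarith
        qed
      qed
    qed
  qed
  \<comment> \<open>Besides making the values finite, this excludes an empty set of minimizers, for
    which the supremum in \<open>devD\<close> would be minus infinity.\<close>
  have min_ex: "\<forall>\<^sub>F N in sequentially. \<exists>u. u \<in> argminset (fs N) (?AN N)"
    using upper[OF zero_less_one] cont_s
  proof eventually_elim
    case (elim N)
    then have "?AN N \<noteq> {}" by blast
    moreover have "compact (?AN N)" using elim(2) by (intro sublevel) simp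
    moreover have "continuous_on (?AN N) (fs N)" using elim(2) by (auto intro: continuous_on_subset)
    ultimately have "\<exists>u\<in>?AN N. \<forall>u'\<in>?AN N. fs N u \<le> fs N u'" by (intro attain)
    then show ?case unfolding argminset_def by blast
  qed
  have optimal: "\<forall>\<^sub>F N in sequentially. \<forall>u\<in>argminset (fs N) (?AN N). \<bar>fs N u - v\<bar> < e" if "0 < e" for e
    using upper[OF that] lower[OF that]
  proof eventually_elim
    case (elim N)
    then obtain u1 where u1: "u1 \<in> ?AN N" "fs N u1 < v + e" by blast
    show ?case
    proof
      fix u assume "u \<in> argminset (fs N) (?AN N)"
      then have "u \<in> ?AN N" "fs N u \<le> fs N u1" using u1(1) by (auto simp: argminset_def)
      then show "\<bar>fs N u - v\<bar> < e" using elim(2) u1(2) by force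
    qed
  qed
  show "(\<lambda>N. infval (fs N) (?AN N)) \<longlonglongrightarrow> infval f ?A"
  proof -
    have "infval f ?A = ereal v" unfolding v_def using u0 by (intro infval_eq) auto
    moreover have "\<forall>\<^sub>F N in sequentially. infval (fs N) (?AN N) = ereal (real_of_ereal (infval (fs N) (?AN N)))"
      using min_ex by eventually_elim (auto simp: argminset_def infval_eq)
    moreover have "(\<lambda>N. real_of_ereal (infval (fs N) (?AN N))) \<longlonglongrightarrow> v"
    proof (rule tendstoI)
      fix e :: real assume "0 < e"
      from min_ex optimal[OF this]
      show "\<forall>\<^sub>F N in sequentially. dist (real_of_ereal (infval (fs N) (?AN N))) v < e"
      proof eventually_elim
        case (elim N)
        then obtain u where u: "u \<in> argminset (fs N) (?AN N)" by blast
        then have "infval (fs N) (?AN N) = ereal (fs N u)" by (intro infval_eq) (auto simp: argminset_def)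
        then show ?case using elim(2) u by (simp add: dist_real_def)
      qed
    qed
    ultimately show ?thesis
      using tendsto_cong[of "\<lambda>N. infval (fs N) (?AN N)" "\<lambda>N. ereal (real_of_ereal (infval (fs N) (?AN N)))"]
      by simp
  qed
  let ?D = "\<lambda>N. devD (argminset (fs N) (?AN N)) (argminset f ?A)"
  have dev: "\<forall>\<^sub>F N in sequentially. 0 \<le> ?D N \<and> ?D N \<le> ereal e" if "0 < e" for e
  proof -
    \<comment> \<open>Points at distance at least \<open>e\<close> from every true minimizer are
      infeasible or suboptimal, with margin \<open>d\<close>. Errors below \<open>d / 2\<close> keep
      the perturbed minimizers out of this set.\<close>
    let ?W = "U - (\<Union>s\<in>argminset f ?A. ball s e)"
    have "compact ?W" using U by (intro compact_diff) auto
    moreover have "g u > K \<or> f u > v" if "u \<in> ?W" for u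
    proof (rule ccontr)
      assume "\<not> ?thesis"
      then have "g u \<le> K" "f u \<le> v" by auto
      then have "u \<in> argminset f ?A" using that u0(2) by (force simp: argminset_def v_def)
      then show False using that \<open>0 < e\<close> by auto
    qed
    ultimately obtain d where d: "d > 0" "\<And>u. u \<in> ?W \<Longrightarrow> g u \<ge> K + d \<or> f u \<ge> v + d"
      using gap[of ?W] by blast
    have "0 < d / 2" using d(1) by simp
    from min_ex close[OF this] optimal[OF this] show ?thesis
    proof eventually_elim
      case (elim N)
      let ?S = "argminset (fs N) (?AN N)"
      have "\<exists>s\<in>argminset f ?A. dist u s \<le> e" if u: "u \<in> ?S" for u
      proof -
        have uN: "u \<in> U" "gs N u \<le> K" using u by (auto simp: argminset_def)
        have "\<bar>fs N u - v\<bar> < d / 2" using elim(3) u by blast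
        moreover have "\<bar>fs N u - f u\<bar> < d / 2" "\<bar>gs N u - g u\<bar> < d / 2" using elim(2) uN(1) by auto
        ultimately have "\<not> g u \<ge> K + d" "\<not> f u \<ge> v + d" using uN(2) d(1) by linarith+
        then have "u \<notin> ?W" using d(2) by blast
        then obtain s where "s \<in> argminset f ?A" "u \<in> ball s e" using uN(1) by blast
        then show ?thesis by (intro bexI[of _ s]) (auto simp: dist_commute)
      qed
      then have "?D N \<le> ereal e"
        unfolding devD_def by (intro SUP_least) (meson INF_lower2 ereal_less_eq(3))
      moreover obtain u where u: "u \<in> ?S" using elim(1) by blast
      have "0 \<le> (INF x'\<in>argminset f ?A. ereal (dist u x'))" by (intro INF_greatest) simp
      then have "0 \<le> ?D N" unfolding devD_def by (rule SUP_upper2[OF u])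
      ultimately show ?case by simp
    qed
  qed
  show "?D \<longlonglongrightarrow> 0"
  proof (rule order_tendstoI)
    fix a :: ereal assume "a < 0"
    then show "\<forall>\<^sub>F N in sequentially. a < ?D N"
      using dev[OF zero_less_one] by (auto elim!: eventually_mono)
  next
    fix a :: ereal assume "0 < a"
    then obtain e where "ereal e < a" "0 < e" by (metis ereal_dense2 ereal_less(2))
    then show "\<forall>\<^sub>F N in sequentially. ?D N < a"
      using dev[of e] by (auto elim!: eventually_mono intro: le_less_trans)
  qed
qed

section \<open>The shortfall constraint\<close>

lemma ex_small_factor:
  fixes v :: "'b::real_normed_vector"
  assumes "0 < e"
  obtains t :: real where "0 < t" "t < 1" "t * norm v < e"
proof -
  define c where "c = norm v + 1"
  have c: "0 < c" "norm v \<le> c" by (simp_all add: c_def add_nonneg_pos)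
  define t where "t = min (1 / 2) (e / (2 * c))"
  have t: "0 < t" "t < 1" using assms c by (auto simp: t_def)
  have "t * norm v \<le> e / (2 * c) * c"
    using c t by (intro mult_mono) (auto simp: t_def)
  also have "\<dots> < e" using c assms by simp
  finally show ?thesis using t by (intro that)
qed

text \<open>Positive homogeneity together with \<open>K > 0\<close> supplies a Slater point: scaling an interior point
  towards the origin makes the constraint strict.\<close>

lemma sublevel_subset_closure_strict_sublevel:
  fixes g :: "'b::real_normed_vector \<Rightarrow> real"
  assumes g: "convex_on U g" and hom: "\<And>c u. 0 \<le> c \<Longrightarrow> g (c *\<^sub>R u) = c * g u" and "0 < K"
    and int: "interior {u\<in>U. g u \<le> K} \<noteq> {}"
  shows "{u\<in>U. g u \<le> K} \<subseteq> closure {u\<in>U. g u < K}"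
proof -
  obtain w where w: "w \<in> U" "g w < K"
  proof -
    obtain u e where u: "0 < e" "ball u e \<subseteq> {u\<in>U. g u \<le> K}"
      using int by (meson ex_in_conv mem_interior)
    \<comment> \<open>The scaled point \<open>(1 - t) *\<^sub>R u\<close> is at distance
      \<open>t * norm u\<close> from \<open>u\<close>, hence stays in the ball and in
      \<open>U\<close>.\<close>
    obtain t where t: "0 < t" "t < 1" "t * norm u < e" using ex_small_factor[OF u(1)] .
    have "u - (1 - t) *\<^sub>R u = t *\<^sub>R u" by (simp add: algebra_simps)
    then have "(1 - t) *\<^sub>R u \<in> ball u e" using t by (simp add: dist_norm)
    then have "(1 - t) *\<^sub>R u \<in> U" using u(2) by blast
    moreover have "u \<in> ball u e" using u(1) by simp
    with u(2) have "g u \<le> K" by blast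
    then have "g ((1 - t) *\<^sub>R u) \<le> (1 - t) * K" using t by (subst hom) auto
    then have "g ((1 - t) *\<^sub>R u) < K" using t \<open>0 < K\<close> by (simp add: algebra_simps) (smt (verit) mult_pos_pos)
    ultimately show ?thesis by (rule that)
  qed
  show ?thesis
  proof
    fix u assume u: "u \<in> {u\<in>U. g u \<le> K}"
    show "u \<in> closure {u\<in>U. g u < K}"
      unfolding closure_approachable
    proof (intro allI impI)
      fix e :: real assume "0 < e"
      then obtain t where t: "0 < t" "t < 1" "t * norm (w - u) < e" using ex_small_factor by blast
      \<comment> \<open>A small step from \<open>u\<close> towards the Slater point \<open>w\<close>
        makes the constraint strict by convexity.\<close>
      let ?y = "(1 - t) *\<^sub>R u + t *\<^sub>R w"
      have "g ?y \<le> (1 - t) * g u + t * g w"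
        using convex_onD[OF g, of t u w] t u w by auto
      also have "\<dots> < (1 - t) * K + t * K"
        using t u w by (intro add_le_less_mono) auto
      finally have "g ?y < K" by (simp add: algebra_simps)
      moreover have "?y \<in> U"
        using convexD_alt[OF convex_on_imp_convex[OF g], of u w t] t u w by auto
      moreover have "?y - u = t *\<^sub>R (w - u)" by (simp add: algebra_simps)
      then have "dist ?y u < e" using t by (simp add: dist_norm)
      ultimately show "\<exists>y\<in>{u\<in>U. g u < K}. dist y u < e" by blast
    qed
  qed
qed

text \<open>Growth at most linear in \<open>x\<close>: a finite first moment gives integrability,
  and boundedness of \<open>u\<close> an integrable envelope.\<close>

lemma shortfall_bound:
  fixes u :: "'b::real_inner \<times> real"
  shows "\<bar>max 0 (- (fst u \<bullet> x) - snd u)\<bar> \<le> norm u * norm x + norm u"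
proof -
  have "\<bar>max 0 (- (fst u \<bullet> x) - snd u)\<bar> \<le> \<bar>fst u \<bullet> x\<bar> + \<bar>snd u\<bar>" by simp
  also have "\<bar>fst u \<bullet> x\<bar> \<le> norm (fst u) * norm x" by (rule Cauchy_Schwarz_ineq2)
  also have "\<dots> \<le> norm u * norm x"
    using norm_fst_le[of "fst u" "snd u"] by (intro mult_right_mono) auto
  also have "\<bar>snd u\<bar> \<le> norm u" using norm_snd_le[of "snd u" "fst u"] by simp
  finally show ?thesis by simp
qed

lemma integrable_shortfall:
  fixes X :: "'a \<Rightarrow> real^'d"
  assumes "finite_measure M" and [measurable]: "X \<in> borel_measurable M" and X: "integrable M (\<lambda>\<omega>. norm (X \<omega>))"
  shows "integrable M (\<lambda>\<omega>. max 0 (- (fst u \<bullet> X \<omega>) - snd u))"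
proof -
  interpret finite_measure M by fact
  show ?thesis
  proof (rule Bochner_Integration.integrable_bound)
    show "integrable M (\<lambda>\<omega>. norm u * norm (X \<omega>) + norm u)" using X by simp
    have "norm (max 0 (- (fst u \<bullet> X \<omega>) - snd u)) \<le> norm (norm u * norm (X \<omega>) + norm u)" for \<omega>
      using shortfall_bound[of u "X \<omega>"] by simp
    then show "AE \<omega> in M. norm (max 0 (- (fst u \<bullet> X \<omega>) - snd u)) \<le> norm (norm u * norm (X \<omega>) + norm u)" by simp
  qed measurable
qed

lemma gfun_scaleR:
  assumes "0 \<le> c"
  shows "gfun M X \<alpha> (c *\<^sub>R u) = c * gfun M X \<alpha> u"
proof -
  have "max 0 (- (fst (c *\<^sub>R u) \<bullet> x) - snd (c *\<^sub>R u)) = c * max 0 (- (fst u \<bullet> x) - snd u)" for x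
    using assms by (simp add: max_mult_distrib_left right_diff_distrib)
  then show ?thesis unfolding gfun_def by (simp add: distrib_left)
qed

text \<open>The integrand is the positive part of a function linear in \<open>u\<close>, hence
  convex for each outcome; integration and the positive factor \<open>inverse (1 - \<alpha>)\<close>
  preserve this.\<close>

lemma convex_on_gfun:
  fixes X :: "'a \<Rightarrow> real^'d"
  assumes M: "finite_measure M" "X \<in> borel_measurable M" "integrable M (\<lambda>\<omega>. norm (X \<omega>))"
    and \<alpha>: "\<alpha> < 1" and U: "convex U"
  shows "convex_on U (gfun M X \<alpha>)"
proof (rule convex_onI[OF _ U])
  fix t :: real and u w :: "(real^'d) \<times> real" assume t: "0 < t" "t < 1"
  let ?h = "\<lambda>u \<omega>. max 0 (- (fst u \<bullet> X \<omega>) - snd u)"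
  note int = integrable_shortfall[OF M]
  have "?h ((1 - t) *\<^sub>R u + t *\<^sub>R w) \<omega> \<le> (1 - t) * ?h u \<omega> + t * ?h w \<omega>" for \<omega>
  proof -
    have "- (fst ((1 - t) *\<^sub>R u + t *\<^sub>R w) \<bullet> X \<omega>) - snd ((1 - t) *\<^sub>R u + t *\<^sub>R w)
        = (1 - t) * (- (fst u \<bullet> X \<omega>) - snd u) + t * (- (fst w \<bullet> X \<omega>) - snd w)"
      by (simp add: inner_add_left algebra_simps)
    also have "\<dots> \<le> (1 - t) * ?h u \<omega> + t * ?h w \<omega>"
      using t by (intro add_mono mult_left_mono) auto
    finally show ?thesis using t by simp
  qed
  then have "(\<integral>\<omega>. ?h ((1 - t) *\<^sub>R u + t *\<^sub>R w) \<omega> \<partial>M) \<le> (\<integral>\<omega>. (1 - t) * ?h u \<omega> + t * ?h w \<omega> \<partial>M)"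
    by (intro integral_mono int Bochner_Integration.integrable_add integrable_mult_right)
  also have "\<dots> = (1 - t) * (\<integral>\<omega>. ?h u \<omega> \<partial>M) + t * (\<integral>\<omega>. ?h w \<omega> \<partial>M)"
    using int by simp
  finally have "inverse (1 - \<alpha>) * (\<integral>\<omega>. ?h ((1 - t) *\<^sub>R u + t *\<^sub>R w) \<omega> \<partial>M)
      \<le> inverse (1 - \<alpha>) * ((1 - t) * (\<integral>\<omega>. ?h u \<omega> \<partial>M) + t * (\<integral>\<omega>. ?h w \<omega> \<partial>M))"
    using \<alpha> by (intro mult_left_mono) auto
  then show "gfun M X \<alpha> ((1 - t) *\<^sub>R u + t *\<^sub>R w) \<le> (1 - t) * gfun M X \<alpha> u + t * gfun M X \<alpha> w"
    unfolding gfun_def by (simp add: algebra_simps)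
qed

lemma boxU_eq: "boxU a b c d = cbox a b \<times> {c..d}"
  by (auto simp: boxU_def mem_box_cart)

lemma uniform_limit_gN:
  fixes X :: "'a \<Rightarrow> real^'d"
  assumes iid: "iid_sample M Xs (distr M borel X)" and [measurable]: "X \<in> borel_measurable M"
    and X: "integrable M (\<lambda>\<omega>. norm (X \<omega>))" and U: "compact U"
  shows "AE \<omega> in M. uniform_limit U (\<lambda>N. gN Xs \<alpha> N \<omega>) (gfun M X \<alpha>) sequentially"
proof -
  interpret iid_sample M Xs "distr M borel X" by (rule iid)
  let ?\<mu> = "distr M borel X"
  let ?f = "\<lambda>u x. max 0 (- (fst u \<bullet> x) - snd u) :: real"
  obtain b where b: "\<And>u. u \<in> U \<Longrightarrow> norm u \<le> b"
    using compact_imp_bounded[OF U] by (auto simp: bounded_iff)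
  have "AE \<omega> in M. uniform_limit U (\<lambda>N u. (\<Sum>j=1..N. ?f u (Xs j \<omega>)) / real N)
      (\<lambda>u. integral\<^sup>L ?\<mu> (?f u)) sequentially"
  proof (rule uniform_law_of_large_numbers[OF U])
    show "(\<lambda>(u, x). ?f u x) \<in> borel_measurable borel"
      unfolding split_beta' by (intro borel_measurable_continuous_onI continuous_intros)
    show "AE x in ?\<mu>. continuous_on U (\<lambda>u. ?f u x)"
      by (intro AE_I2 continuous_intros)
    show "integrable ?\<mu> (\<lambda>x. b * norm x + b)"
      using X by (subst integrable_distr_eq) auto
    have "\<bar>?f u x\<bar> \<le> b * norm x + b" if "u \<in> U" for u x
      using shortfall_bound[of u x] mult_right_mono[OF b[OF that], of "norm x"] b[OF that] norm_ge_zero[of x] by linarith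
    then show "AE x in ?\<mu>. \<forall>u\<in>U. \<bar>?f u x\<bar> \<le> b * norm x + b" by blast
  qed
  then show ?thesis
  proof eventually_elim
    case (elim \<omega>)
    have "uniform_limit U (\<lambda>N u. snd u + inverse (1 - \<alpha>) * ((\<Sum>j=1..N. ?f u (Xs j \<omega>)) / real N))
      (\<lambda>u. snd u + inverse (1 - \<alpha>) * integral\<^sup>L ?\<mu> (?f u)) sequentially"
      by (intro uniform_limit_add uniform_limit_const bounded_linear.uniform_limit[OF bounded_linear_mult_right elim])
    moreover have "integral\<^sup>L ?\<mu> (?f u) = (\<integral>\<omega>. ?f u (X \<omega>) \<partial>M)" for u
      by (rule integral_distr) auto
    ultimately show ?case by (simp add: gN_def[abs_def] gfun_def[abs_def] divide_inverse ac_simps)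
  qed
qed

section \<open>Consistency of the sampled values and minimizers\<close>

theorem mainTheorem7:
  fixes M :: "'a measure"
    and X :: "'a \<Rightarrow> real^'d"
    and Xs :: "nat \<Rightarrow> 'a \<Rightarrow> real^'d"
    and L :: "(real^'d) \<times> real \<Rightarrow> real^'d \<Rightarrow> real"
    and \<alpha> K \<zeta>l \<zeta>u :: real
    and \<gamma>l \<gamma>u :: "real^'d"
  defines "U \<equiv> boxU \<gamma>l \<gamma>u \<zeta>l \<zeta>u"
  defines "UK \<equiv> {u \<in> U. gfun M X \<alpha> u \<le> K}"
  defines "UNK \<equiv> (\<lambda>N \<omega>. {u \<in> U. gN Xs \<alpha> N \<omega> u \<le> K})"
  assumes P: "prob_space M"
    and X_meas: "X \<in> borel_measurable M"
    and X_int: "integrable M (\<lambda>\<omega>. norm (X \<omega>))"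
    and Xs_meas: "\<And>j. j \<ge> 1 \<Longrightarrow> Xs j \<in> borel_measurable M"
    and Xs_indep: "prob_space.indep_vars M (\<lambda>_. borel) Xs {1..}"
    and Xs_distr: "\<And>j. j \<ge> 1 \<Longrightarrow> distr M borel (Xs j) = distr M borel X"
    and \<alpha>: "0 < \<alpha>" "\<alpha> < 1"
    and K: "0 < K"
    and \<gamma>bounds: "\<And>i. 0 \<le> \<gamma>l$i \<and> \<gamma>l$i \<le> \<gamma>u$i"
    and \<zeta>bounds: "\<zeta>l \<le> \<zeta>u"
    and L_meas: "(\<lambda>(u, x). L u x) \<in> borel_measurable borel"
    and P1: "AE \<omega> in M. continuous_on U (\<lambda>u. L u (X \<omega>)) \<and> convex_on U (\<lambda>u. L u (X \<omega>))"
    and P2: "(\<integral>\<^sup>+ \<omega>. (SUP u\<in>U. ennreal \<bar>L u (X \<omega>)\<bar>) \<partial>M) < \<infinity>"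
    and intU: "interior U \<noteq> {}"
    and intUK: "interior UK \<noteq> {}"
  shows "AE \<omega> in M.
           (\<lambda>N. infval (ellN L Xs N \<omega>) (UNK N \<omega>)) \<longlonglongrightarrow> infval (ell M L X) UK
         \<and> (\<lambda>N. devD (argminset (ellN L Xs N \<omega>) (UNK N \<omega>)) (argminset (ell M L X) UK))
             \<longlonglongrightarrow> 0"
  proof -
  interpret prob_space M by (rule P)
  interpret iid_sample M Xs "distr M borel X"
    by unfold_locales (use Xs_meas Xs_indep Xs_distr in auto)
  have U: "compact U" "convex U"
    unfolding U_def boxU_eq by (auto intro: compact_Times convex_Times)
  \<comment> \<open>Hypothesis \<open>P1\<close> concerns \<open>X\<close> only; as a statement
    about its law, continuity becomes available for every copy \<open>Xs j\<close>.\<close>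
  have cont: "AE x in distr M borel X. continuous_on U (\<lambda>u. L u x)"
    using P1 by (intro AE_continuous_on_from_pullback finite_measure_axioms X_meas U L_meas) auto
  obtain F where F: "integrable (distr M borel X) F" "AE x in distr M borel X. \<forall>u\<in>U. \<bar>L u x\<bar> \<le> F x"
    using integrable_envelope[OF X_meas L_meas cont P2] .
  have "AE \<omega> in M. uniform_limit U (\<lambda>N. ellN L Xs N \<omega>) (ell M L X) sequentially"
  proof -
    have "integral\<^sup>L (distr M borel X) (L u) = (\<integral>\<omega>. L u (X \<omega>) \<partial>M)" for u
      by (rule integral_distr[OF X_meas jointly_measurable_section[OF L_meas]])
    then show ?thesis
      using uniform_law_of_large_numbers[OF U(1) L_meas cont F]
      by (simp add: ellN_def[abs_def] ell_def[abs_def])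
  qed
  moreover have "AE \<omega> in M. uniform_limit U (\<lambda>N. gN Xs \<alpha> N \<omega>) (gfun M X \<alpha>) sequentially"
    by (rule uniform_limit_gN[OF iid_sample_axioms X_meas X_int U(1)])
  moreover have "AE \<omega> in M. \<forall>j\<ge>1. continuous_on U (\<lambda>u. L u (Xs j \<omega>))"
    by (rule AE_sample[OF cont])
  ultimately show ?thesis
  proof eventually_elim
    case (elim \<omega>)
    \<comment> \<open>Continuity of the sampled objective and constraint gives compact feasible sets
      and attained minima.\<close>
    have "continuous_on U (ellN L Xs N \<omega>)" for N
      unfolding ellN_def[abs_def] divide_inverse using elim(3)
      by (intro continuous_intros) auto
    moreover have "continuous_on U (gN Xs \<alpha> N \<omega>)" for N
      unfolding gN_def[abs_def] by (intro continuous_intros)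
    ultimately have c: "\<forall>\<^sub>F N in sequentially. continuous_on U (ellN L Xs N \<omega>) \<and> continuous_on U (gN Xs \<alpha> N \<omega>)"
      by simp
    have ne: "{u\<in>U. gfun M X \<alpha> u \<le> K} \<noteq> {}"
      using intUK interior_subset[of UK] unfolding UK_def by blast
    have "{u\<in>U. gfun M X \<alpha> u \<le> K} \<subseteq> closure {u\<in>U. gfun M X \<alpha> u < K}"
      using intUK unfolding UK_def
      by (intro sublevel_subset_closure_strict_sublevel convex_on_gfun finite_measure_axioms
          X_meas X_int \<alpha> U gfun_scaleR K)
    from argmin_stability[OF U(1) elim(1,2) c ne this]
    show ?case unfolding UK_def UNK_def by simp
  qed
qed

end
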